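(* Let $\mathbf{T}\equiv\mathbf{T}(x_0,x_1,y_0,a)\in\mathcal{SFC}$ with data $x_0,x_1,\dots$; $y_0,y_1,\dots$; $a$; $p,q$; $\eta_1$, and put $$h:=\sqrt{\frac{x_0^2y_1^2(x_1^2-x_0^2)}{x_0^2(x_1^2-x_0^2)+(a^2-x_0^2)^2}},\qquad s:=\min\left\{\sqrt{\frac{q}{a^2}},\ \sqrt{\frac{p}{\left\|\frac1t\right\|_{L^1(\eta_1)}-a^2}}\right\}.$$ Assume that $y_1<1$, that $x_0\sqrt{\frac{1-x_1^2}{1-x_0^2}}<a\leq x_0$, and that $p+q<1$. Then the interval $(s,h]$ is nonempty, and if $y_0\in(s,h]$ then $\mathbf{T}$ is (jointly) hyponormal but not subnormal.
   Context: $2$-variable weighted shifts: for bounded families of positive numbers $\{\alpha_{\mathbf{k}}\},\{\beta_{\mathbf{k}}\}$, $\mathbf{k}\in\mathbb{Z}_+^2$, the pair $\mathbf{T}\equiv(T_1,T_2)$ on $\ell^2(\mathbb{Z}_+^2)$ is $T_1e_{\mathbf{k}}=\alpha_{\mathbf{k}}e_{\mathbf{k}+(1,0)}$, $T_2e_{\mathbf{k}}=\beta_{\mathbf{k}}e_{\mathbf{k}+(0,1)}$; it is commuting iff $\beta_{\mathbf{k}+(1,0)}\alpha_{\mathbf{k}}=\alpha_{\mathbf{k}+(0,1)}\beta_{\mathbf{k}}$ for all $\mathbf{k}$. With $[S,T]:=ST-TS$, a commuting pair is (jointly) hyponormal if $\begin{pmatrix}[T_1^*,T_1]&[T_2^*,T_1]\\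 [T_1^*,T_2]&[T_2^*,T_2]\end{pmatrix}\geq0$. An operator is subnormal if it is the restriction of a normal operator to an invariant subspace; a commuting pair is subnormal if it is the restriction of a commuting pair of normal operators to a common invariant subspace. $shift(\omega_0,\omega_1,\dots)$ is the unilateral weighted shift $e_k\mapsto\omega_ke_{k+1}$ on $\ell^2(\mathbb{Z}_+)$; when it is subnormal, its Berger measure is the unique compactly supported probability measure $\xi$ on $[0,\infty)$ with $\omega_0^2\cdots\omega_{k-1}^2=\int t^k\,d\xi(t)$ for all $k\geq 1$. The class $\mathcal{SFC}$ (symmetrically flat, contractive, with subnormal coordinates) consists of the commuting $2$-variable weighted shifts with $\alpha_{\mathbf{k}}=\beta_{\mathbf{k}}=1$ for all $\mathbf{k}=(k_1,k_2)$ with $k_1,k_2\geq1$, $\|T_1\|\leq1$, $\|T_2\|\leq1$, and $T_1$, $T_2$ subnormal. Notation: $x_n:=\alpha_{(n,0)}$, $y_n:=\beta_{(0,n)}$, $a:=\alpha_{(0,1)}$; $\xi$, $\eta$ and $\eta_1$ are the Berger measures of $shift(x_0,x_1,\dots)$, $shift(y_0,y_1,\dots)$ and $shift(y_1,y_2,\dots)$. By commutativity the remaining weights are $\alpha_{(0,n)}=a/(y_1\cdots y_{n-1})$ for $n\geq2$ and $\beta_{(n,0)}=ay_0/(x_0\cdots x_{n-1})$ for $n\geq1$. Standing assumption of the paper: $\xi=p\delta_0+q\delta_1+[1-(p+q)]\rho$ and $\eta=u\delta_0+v\delta_1+[1-(u+v)]\sigma$, where $0<p,q,u,v<1$, $p+q\leq1$,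 $u+v\leq1$, and $\rho,\sigma$ are probability measures with $\rho(\{0\}\cup\{1\})=\sigma(\{0\}\cup\{1\})=0$. *)

theory Defs
  imports "HOL-Probability.Probability"
begin

class chilbert_space = banach +
  fixes scaleC :: "complex \<Rightarrow> 'a \<Rightarrow> 'a" (infixr "*\<^sub>C" 75)
    and cinner :: "'a \<Rightarrow> 'a \<Rightarrow> complex"
  assumes scaleR_scaleC: "scaleR r x = complex_of_real r *\<^sub>C x"
    and scaleC_add_right: "c *\<^sub>C (x + y) = c *\<^sub>C x + c *\<^sub>C y"
    and scaleC_add_left: "(c + d) *\<^sub>C x = c *\<^sub>C x + d *\<^sub>C x"
    and scaleC_scaleC: "c *\<^sub>C (d *\<^sub>C x) = (c * d) *\<^sub>C x"
    and cinner_add_left: "cinner (x + y) z = cinner x z + cinner y z"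
    and cinner_scaleC_left: "cinner (c *\<^sub>C x) y = c * cinner x y"
    and cinner_commute: "cinner x y = cnj (cinner y x)"
    and cinner_norm: "cinner x x = complex_of_real ((norm x)\<^sup>2)"

lemma cinner_add_right: "cinner x (y + z) = cinner x y + cinner x z"
  by (metis cinner_add_left cinner_commute complex_cnj_add)

lemma cinner_scaleC_right: "cinner x (c *\<^sub>C y) = cnj c * cinner x y"
  by (metis cinner_scaleC_left cinner_commute complex_cnj_mult)

lemma minus_scaleC: "- x = (- 1) *\<^sub>C (x :: 'a::chilbert_space)"
  using scaleR_scaleC[of "- 1" x] by simp

lemma cinner_minus_left: "cinner (- x) y = - cinner x y"
  by (metis minus_scaleC cinner_scaleC_left mult_minus1)

lemma cinner_minus_right: "cinner x (- y) = - cinner x y"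
  by (metis cinner_minus_left cinner_commute complex_cnj_minus)

lemma cinner_diff_left: "cinner (x - y) z = cinner x z - cinner y z"
  using cinner_add_left[of x "- y" z] by (simp add: cinner_minus_left)

lemma cinner_diff_right: "cinner x (y - z) = cinner x y - cinner x z"
  using cinner_add_right[of x y "- z"] by (simp add: cinner_minus_right)

lemma cinner_zero_left [simp]: "cinner 0 x = 0"
  by (metis cinner_diff_left diff_self)

lemma cinner_zero_right [simp]: "cinner x 0 = 0"
  by (metis cinner_diff_right diff_self)

lemma cinner_ext: "(\<And>z. cinner x z = cinner y z) \<Longrightarrow> x = y"
proof -
  assume *: "\<And>z. cinner x z = cinner y z"
  have "cinner (x - y) (x - y) = 0"
    by (simp add: cinner_diff_left *)
  then show ?thesis by (simp add: cinner_norm)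
qed

lemma norm_add_sq:
  fixes x y :: "'a::chilbert_space"
  shows "(norm (x + y))\<^sup>2 = (norm x)\<^sup>2 + (norm y)\<^sup>2 + 2 * Re (cinner x y)"
proof -
  have "Re (cinner (x + y) (x + y)) = Re (cinner x x) + Re (cinner y y) + 2 * Re (cinner x y)"
    using cinner_commute[of y x] by (simp add: cinner_add_left cinner_add_right)
  then show ?thesis by (simp add: cinner_norm)
qed

lemma parallelogram:
  fixes x y :: "'a::chilbert_space"
  shows "(norm (x + y))\<^sup>2 + (norm (x - y))\<^sup>2 = 2 * (norm x)\<^sup>2 + 2 * (norm y)\<^sup>2"
  using norm_add_sq[of x y] norm_add_sq[of x "- y"] by (simp add: cinner_minus_right)

lemma norm_scaleC: "norm (c *\<^sub>C x) = cmod c * norm x"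
proof -
  have "complex_of_real ((norm (c *\<^sub>C x))\<^sup>2) = (c * cnj c) * complex_of_real ((norm x)\<^sup>2)"
    using cinner_norm[of "c *\<^sub>C x"] cinner_norm[of x]
    by (simp add: cinner_scaleC_left cinner_scaleC_right mult_ac)
  also have "\<dots> = complex_of_real ((cmod c * norm x)\<^sup>2)"
    by (simp only: complex_mult_cnj cmod_power2[symmetric] power_mult_distrib of_real_mult)
  finally have "(norm (c *\<^sub>C x))\<^sup>2 = (cmod c * norm x)\<^sup>2"
    by (simp only: of_real_eq_iff)
  then show ?thesis by simp
qed

lemma cinner_cauchy_schwarz: "cmod (cinner x y) \<le> norm x * norm y"
proof (cases "y = 0")
  case False
  define n where "n = complex_of_real ((norm y)\<^sup>2)"
  define c where "c = cinner x y / n"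
  have n0: "n \<noteq> 0" using False by (simp add: n_def)
  have "cinner (x - c *\<^sub>C y) y = 0"
    using n0 by (simp add: cinner_diff_left cinner_scaleC_left c_def cinner_norm n_def)
  then have "Re (cinner (x - c *\<^sub>C y) (c *\<^sub>C y)) = 0"
    by (simp add: cinner_scaleC_right)
  then have "(norm x)\<^sup>2 = (norm (x - c *\<^sub>C y))\<^sup>2 + (norm (c *\<^sub>C y))\<^sup>2"
    using norm_add_sq[of "x - c *\<^sub>C y" "c *\<^sub>C y"] by simp
  then have "(norm (c *\<^sub>C y))\<^sup>2 \<le> (norm x)\<^sup>2" by simp
  then have "cmod c * norm y \<le> norm x" by (simp add: norm_scaleC)
  moreover have "cmod c = cmod (cinner x y) / (norm y)\<^sup>2"
    by (simp add: c_def n_def norm_divide norm_power)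
  ultimately have "cmod (cinner x y) / norm y \<le> norm x"
    using False by (simp add: power2_eq_square field_simps)
  then show ?thesis using False by (simp add: field_simps)
qed simp

typedef 'i ell2 = "{f :: 'i \<Rightarrow> complex. (\<lambda>i. (cmod (f i))\<^sup>2) summable_on UNIV}"
  morphisms coord Abs_ell2
  by (rule exI[of _ "\<lambda>_. 0"]) simp

setup_lifting type_definition_ell2

lemma coord_summable: "(\<lambda>i. (cmod (coord f i))\<^sup>2) summable_on UNIV"
  using coord[of f] by simp

lemma ell2_finite_bound:
  fixes f :: "'i \<Rightarrow> complex"
  assumes "\<And>F. finite F \<Longrightarrow> L2_set (\<lambda>i. cmod (f i)) F \<le> B"
  shows "(\<lambda>i. (cmod (f i))\<^sup>2) summable_on UNIV" "(\<Sum>\<^sub>\<infinity>i. (cmod (f i))\<^sup>2) \<le> B\<^sup>2"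
proof -
  have B: "(\<Sum>i\<in>F. (cmod (f i))\<^sup>2) \<le> B\<^sup>2" if "finite F" for F
    using assms[OF that] by (simp add: L2_set_def sqrt_le_D)
  show "(\<lambda>i. (cmod (f i))\<^sup>2) summable_on UNIV"
    by (rule nonneg_bdd_above_summable_on) (auto intro!: bdd_aboveI2[where M = "B\<^sup>2"] B)
  then show "(\<Sum>\<^sub>\<infinity>i. (cmod (f i))\<^sup>2) \<le> B\<^sup>2"
    by (rule infsum_le_finite_sums) (use B in auto)
qed

lemma ell2_L2_set:
  fixes f :: "'i \<Rightarrow> complex"
  assumes "(\<lambda>i. (cmod (f i))\<^sup>2) summable_on UNIV" "finite F"
  shows "L2_set (\<lambda>i. cmod (f i)) F \<le> sqrt (\<Sum>\<^sub>\<infinity>i. (cmod (f i))\<^sup>2)"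
  unfolding L2_set_def using finite_sum_le_infsum[OF assms] by simp

lemma L2_set_cmod_triangle:
  "L2_set (\<lambda>i. cmod (f i + g i)) F \<le> L2_set (\<lambda>i. cmod (f i)) F + L2_set (\<lambda>i. cmod (g i)) F"
  by (rule order_trans[OF L2_set_mono L2_set_triangle_ineq]) (auto intro: norm_triangle_ineq)

lemma ell2_add:
  fixes f g :: "'i \<Rightarrow> complex"
  assumes f: "(\<lambda>i. (cmod (f i))\<^sup>2) summable_on UNIV" and g: "(\<lambda>i. (cmod (g i))\<^sup>2) summable_on UNIV"
  shows "(\<lambda>i. (cmod (f i + g i))\<^sup>2) summable_on UNIV"
    and "sqrt (\<Sum>\<^sub>\<infinity>i. (cmod (f i + g i))\<^sup>2)
          \<le> sqrt (\<Sum>\<^sub>\<infinity>i. (cmod (f i))\<^sup>2) + sqrt (\<Sum>\<^sub>\<infinity>i. (cmod (g i))\<^sup>2)"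
proof -
  let ?B = "sqrt (\<Sum>\<^sub>\<infinity>i. (cmod (f i))\<^sup>2) + sqrt (\<Sum>\<^sub>\<infinity>i. (cmod (g i))\<^sup>2)"
  have *: "L2_set (\<lambda>i. cmod (f i + g i)) F \<le> ?B" if "finite F" for F
    using L2_set_cmod_triangle[of f g F] ell2_L2_set[OF f that] ell2_L2_set[OF g that] by linarith
  show "(\<lambda>i. (cmod (f i + g i))\<^sup>2) summable_on UNIV"
    by (rule ell2_finite_bound) (rule *)
  have "(\<Sum>\<^sub>\<infinity>i. (cmod (f i + g i))\<^sup>2) \<le> ?B\<^sup>2"
    by (rule ell2_finite_bound) (rule *)
  moreover have "0 \<le> ?B" by (simp add: infsum_nonneg)
  ultimately show "sqrt (\<Sum>\<^sub>\<infinity>i. (cmod (f i + g i))\<^sup>2) \<le> ?B"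
    by (simp add: real_le_lsqrt)
qed

lemma ell2_scale:
  fixes f :: "'i \<Rightarrow> complex"
  assumes "(\<lambda>i. (cmod (f i))\<^sup>2) summable_on UNIV"
  shows "(\<lambda>i. (cmod (c * f i))\<^sup>2) summable_on UNIV"
  using summable_on_cmult_right[OF assms, of "(cmod c)\<^sup>2"] by (simp add: norm_mult power_mult_distrib)

lemma ell2_uminus:
  fixes f :: "'i \<Rightarrow> complex"
  assumes "(\<lambda>i. (cmod (f i))\<^sup>2) summable_on UNIV"
  shows "(\<lambda>i. (cmod (- f i))\<^sup>2) summable_on UNIV"
  using assms by simp

lemma ell2_diff:
  fixes f g :: "'i \<Rightarrow> complex"
  assumes f: "(\<lambda>i. (cmod (f i))\<^sup>2) summable_on UNIV" and g: "(\<lambda>i. (cmod (g i))\<^sup>2) summable_on UNIV"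
  shows "(\<lambda>i. (cmod (f i - g i))\<^sup>2) summable_on UNIV"
  using ell2_add(1)[OF f ell2_uminus[OF g]] by simp

lemma ell2_prod_summable: "(\<lambda>i. coord f i * cnj (coord g i)) summable_on UNIV"
proof -
  have "(\<lambda>i. (cmod (coord f i))\<^sup>2 + (cmod (coord g i))\<^sup>2) summable_on UNIV"
    by (intro summable_on_add coord_summable)
  moreover have "norm (coord f i * cnj (coord g i)) \<le> (cmod (coord f i))\<^sup>2 + (cmod (coord g i))\<^sup>2" for i
  proof -
    have "0 \<le> (cmod (coord f i) - cmod (coord g i))\<^sup>2" "0 \<le> cmod (coord f i) * cmod (coord g i)"
      by simp_all
    then show ?thesis unfolding norm_mult complex_mod_cnj power2_diff by linarith
  qed
  ultimately have "(\<lambda>i. norm (coord f i * cnj (coord g i))) summable_on UNIV"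
    by (rule Infinite_Sum.abs_summable_on_comparison_test')
  then show ?thesis by (rule abs_summable_summable)
qed

instantiation ell2 :: (type) real_normed_vector
begin

lift_definition zero_ell2 :: "'a ell2" is "\<lambda>_. 0" by simp
lift_definition plus_ell2 :: "'a ell2 \<Rightarrow> 'a ell2 \<Rightarrow> 'a ell2" is "\<lambda>f g i. f i + g i"
  by (rule ell2_add)
lift_definition minus_ell2 :: "'a ell2 \<Rightarrow> 'a ell2 \<Rightarrow> 'a ell2" is "\<lambda>f g i. f i - g i"
  by (rule ell2_diff)
lift_definition uminus_ell2 :: "'a ell2 \<Rightarrow> 'a ell2" is "\<lambda>f i. - f i"
  by (rule ell2_uminus)
lift_definition scaleR_ell2 :: "real \<Rightarrow> 'a ell2 \<Rightarrow> 'a ell2" is "\<lambda>r f i. complex_of_real r * f i"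
  by (rule ell2_scale)
definition norm_ell2 :: "'a ell2 \<Rightarrow> real" where
  "norm_ell2 f = sqrt (\<Sum>\<^sub>\<infinity>i. (cmod (coord f i))\<^sup>2)"
definition dist_ell2 :: "'a ell2 \<Rightarrow> 'a ell2 \<Rightarrow> real" where
  "dist_ell2 f g = norm (f - g)"
definition sgn_ell2 :: "'a ell2 \<Rightarrow> 'a ell2" where
  "sgn_ell2 f = scaleR (inverse (norm f)) f"
definition uniformity_ell2 :: "('a ell2 \<times> 'a ell2) filter" where
  "uniformity_ell2 = (INF e\<in>{0<..}. principal {(x, y). dist x y < e})"
definition open_ell2 :: "'a ell2 set \<Rightarrow> bool" where
  "open_ell2 U = (\<forall>x\<in>U. eventually (\<lambda>(x', y). x' = x \<longrightarrow> y \<in> U) uniformity)"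

lemma norm_ell2_nonneg: "0 \<le> norm (f :: 'a ell2)"
  by (simp add: norm_ell2_def infsum_nonneg)

lemma norm_ell2_sq: "(norm (f :: 'a ell2))\<^sup>2 = (\<Sum>\<^sub>\<infinity>i. (cmod (coord f i))\<^sup>2)"
  by (simp add: norm_ell2_def infsum_nonneg)

lemma L2_set_le_norm: "finite F \<Longrightarrow> L2_set (\<lambda>i. cmod (coord f i)) F \<le> norm (f :: 'a ell2)"
  unfolding norm_ell2_def by (rule ell2_L2_set[OF coord_summable])

lemma coord_le_norm: "cmod (coord f i) \<le> norm (f :: 'a ell2)"
  using L2_set_le_norm[of "{i}" f] by simp

lemma norm_ell2_le:
  assumes "\<And>F. finite F \<Longrightarrow> L2_set (\<lambda>i. cmod (coord f i)) F \<le> B" "0 \<le> B"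
  shows "norm (f :: 'a ell2) \<le> B"
  unfolding norm_ell2_def using ell2_finite_bound(2)[of "coord f" B] assms
  by (simp add: real_le_lsqrt)

lemma ell2_eqI: "(\<And>i. coord f i = coord g i) \<Longrightarrow> f = (g :: 'a ell2)"
  by (simp add: coord_inject[symmetric] ext)

instance
proof
  fix f g h :: "'a ell2" and r r' :: real
  show "f + g + h = f + (g + h)" "f + g = g + f" "0 + f = f" "- f + f = 0" "f - g = f + - g"
    by (transfer; simp add: fun_eq_iff)+
  show "r *\<^sub>R (f + g) = r *\<^sub>R f + r *\<^sub>R g" "(r + r') *\<^sub>R f = r *\<^sub>R f + r' *\<^sub>R f"
    "r *\<^sub>R r' *\<^sub>R f = (r * r') *\<^sub>R f" "1 *\<^sub>R f = f"
    by (transfer; simp add: fun_eq_iff algebra_simps)+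
  show "dist f g = norm (f - g)" by (rule dist_ell2_def)
  show "sgn f = inverse (norm f) *\<^sub>R f" by (rule sgn_ell2_def)
  show "uniformity = (INF e\<in>{0<..}. principal {(x, y :: 'a ell2). dist x y < e})"
    by (rule uniformity_ell2_def)
  show "open U = (\<forall>x\<in>U. \<forall>\<^sub>F (x', y) in uniformity. x' = x \<longrightarrow> y \<in> U)" for U :: "'a ell2 set"
    by (rule open_ell2_def)
  show "norm f = 0 \<longleftrightarrow> f = 0"
  proof
    assume "norm f = 0"
    then show "f = 0" using coord_le_norm[of f] by (intro ell2_eqI) (simp add: zero_ell2.rep_eq)
  qed (simp add: norm_ell2_def zero_ell2.rep_eq)
  show "norm (f + g) \<le> norm f + norm g"
    unfolding norm_ell2_def plus_ell2.rep_eq by (rule ell2_add(2)[OF coord_summable coord_summable])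
  show "norm (r *\<^sub>R f) = \<bar>r\<bar> * norm f"
    by (simp add: norm_ell2_def scaleR_ell2.rep_eq norm_mult power_mult_distrib
        infsum_cmult_right' real_sqrt_mult)
qed

end

instantiation ell2 :: (type) chilbert_space
begin

lift_definition scaleC_ell2 :: "complex \<Rightarrow> 'a ell2 \<Rightarrow> 'a ell2" is "\<lambda>c f i. c * f i"
  by (rule ell2_scale)
definition cinner_ell2 :: "'a ell2 \<Rightarrow> 'a ell2 \<Rightarrow> complex" where
  "cinner_ell2 f g = (\<Sum>\<^sub>\<infinity>i. coord f i * cnj (coord g i))"

instance
proof
  fix f g h :: "'a ell2" and r :: real and c d :: complex
  show "r *\<^sub>R f = complex_of_real r *\<^sub>C f"
    by (rule ell2_eqI) (simp add: scaleR_ell2.rep_eq scaleC_ell2.rep_eq)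
  show "c *\<^sub>C (f + g) = c *\<^sub>C f + c *\<^sub>C g" "(c + d) *\<^sub>C f = c *\<^sub>C f + d *\<^sub>C f"
    "c *\<^sub>C d *\<^sub>C f = (c * d) *\<^sub>C f"
    by (transfer; simp add: fun_eq_iff algebra_simps)+
  show "cinner (f + g) h = cinner f h + cinner g h"
    by (simp add: cinner_ell2_def plus_ell2.rep_eq distrib_right infsum_add ell2_prod_summable)
  show "cinner (c *\<^sub>C f) g = c * cinner f g"
    by (simp add: cinner_ell2_def scaleC_ell2.rep_eq mult.assoc infsum_cmult_right')
  show "cinner f g = cnj (cinner g f)"
    by (simp add: cinner_ell2_def mult.commute flip: infsum_cnj)
  show "cinner f f = complex_of_real ((norm f)\<^sup>2)"
  proof -
    have "cinner f f = (\<Sum>\<^sub>\<infinity>i. complex_of_real ((cmod (coord f i))\<^sup>2))"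
      by (simp only: cinner_ell2_def complex_mult_cnj cmod_power2)
    also have "\<dots> = complex_of_real (\<Sum>\<^sub>\<infinity>i. (cmod (coord f i))\<^sup>2)"
      by (rule infsumI, rule has_sum_of_real, rule has_sum_infsum, rule coord_summable)
    finally show ?thesis by (simp only: norm_ell2_sq)
  qed
next
  fix X :: "nat \<Rightarrow> 'a ell2"
  assume "Cauchy X"
  have dist_norm': "dist f g = norm (f - g)" for f g :: "'a ell2" by (rule dist_ell2_def)
  have "Cauchy (\<lambda>n. coord (X n) i)" for i
  proof (rule metric_CauchyI)
    fix e :: real assume "0 < e"
    then obtain N where N: "\<And>m n. m \<ge> N \<Longrightarrow> n \<ge> N \<Longrightarrow> dist (X m) (X n) < e"
      using metric_CauchyD[OF \<open>Cauchy X\<close>] by blast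
    have "dist (coord (X m) i) (coord (X n) i) \<le> dist (X m) (X n)" for m n
      using coord_le_norm[of "X m - X n" i] by (simp add: dist_norm' dist_norm minus_ell2.rep_eq)
    then show "\<exists>N. \<forall>m\<ge>N. \<forall>n\<ge>N. dist (coord (X m) i) (coord (X n) i) < e"
      using N by (meson order_le_less_trans)
  qed
  then have "\<exists>l. (\<lambda>n. coord (X n) i) \<longlonglongrightarrow> l" for i
    by (simp add: Cauchy_convergent_iff convergent_def)
  then obtain l where l: "\<And>i. (\<lambda>n. coord (X n) i) \<longlonglongrightarrow> l i" by metis
  have *: "\<exists>N. \<forall>m\<ge>N. \<forall>F. finite F \<longrightarrow> L2_set (\<lambda>i. cmod (l i - coord (X m) i)) F \<le> e" if e: "0 < e" for e
  proof -
    obtain N where N: "\<And>m n. m \<ge> N \<Longrightarrow> n \<ge> N \<Longrightarrow> dist (X m) (X n) < e"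
      using metric_CauchyD[OF \<open>Cauchy X\<close> e] by blast
    have "L2_set (\<lambda>i. cmod (l i - coord (X m) i)) F \<le> e" if "m \<ge> N" "finite F" for m F
    proof (rule LIMSEQ_le_const2)
      show "(\<lambda>n. L2_set (\<lambda>i. cmod (coord (X n) i - coord (X m) i)) F)
              \<longlonglongrightarrow> L2_set (\<lambda>i. cmod (l i - coord (X m) i)) F"
        unfolding L2_set_def by (intro tendsto_intros l)
      have "L2_set (\<lambda>i. cmod (coord (X n) i - coord (X m) i)) F \<le> e" if "n \<ge> N" for n
        using L2_set_le_norm[OF \<open>finite F\<close>, of "X n - X m"] N[OF that \<open>m \<ge> N\<close>]
        by (simp add: minus_ell2.rep_eq dist_norm')
      then show "\<exists>N. \<forall>n\<ge>N. L2_set (\<lambda>i. cmod (coord (X n) i - coord (X m) i)) F \<le> e"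
        by blast
    qed
    then show ?thesis by blast
  qed
  obtain N1 where N1: "\<And>F. finite F \<Longrightarrow> L2_set (\<lambda>i. cmod (l i - coord (X N1) i)) F \<le> 1"
    using *[of 1] by auto
  have "(\<lambda>i. (cmod (l i - coord (X N1) i))\<^sup>2) summable_on UNIV"
    by (rule ell2_finite_bound) (rule N1)
  from ell2_add(1)[OF this coord_summable[of "X N1"]]
  have "(\<lambda>i. (cmod (l i))\<^sup>2) summable_on UNIV" by simp
  then have co: "coord (Abs_ell2 l) = l" by (simp add: Abs_ell2_inverse)
  have "X \<longlonglongrightarrow> Abs_ell2 l"
  proof (rule metric_LIMSEQ_I)
    fix e :: real assume "0 < e"
    then obtain N where N: "\<And>m F. m \<ge> N \<Longrightarrow> finite F \<Longrightarrow> L2_set (\<lambda>i. cmod (l i - coord (X m) i)) F \<le> e / 2"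
      using *[of "e / 2"] by auto
    have "dist (X m) (Abs_ell2 l) < e" if "m \<ge> N" for m
    proof -
      have "norm (X m - Abs_ell2 l) \<le> e / 2"
        by (rule norm_ell2_le) (use N[OF that] \<open>0 < e\<close> in \<open>auto simp: minus_ell2.rep_eq co norm_minus_commute\<close>)
      then show ?thesis using \<open>0 < e\<close> by (simp add: dist_norm')
    qed
    then show "\<exists>N. \<forall>m\<ge>N. dist (X m) (Abs_ell2 l) < e" by blast
  qed
  then show "convergent X" by (auto simp: convergent_def)
qed

end

definition ket :: "'i \<Rightarrow> 'i ell2" where
  "ket k = Abs_ell2 (\<lambda>i. if i = k then 1 else 0)"

lemma coord_ket: "coord (ket k) i = (if i = k then 1 else 0)"
proof -
  have "(\<lambda>i. (cmod (if i = k then 1 else 0))\<^sup>2) summable_on UNIV"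
    by (rule finite_nonzero_values_imp_summable_on, rule finite_subset[of _ "{k}"]) auto
  then show ?thesis by (simp add: ket_def Abs_ell2_inverse)
qed

definition bounded_clinear :: "('a::chilbert_space \<Rightarrow> 'b::chilbert_space) \<Rightarrow> bool" where
  "bounded_clinear T \<longleftrightarrow> bounded_linear T \<and> (\<forall>c x. T (c *\<^sub>C x) = c *\<^sub>C T x)"

definition cadj :: "('a::chilbert_space \<Rightarrow> 'b::chilbert_space) \<Rightarrow> 'b \<Rightarrow> 'a" where
  "cadj T = (THE S. \<forall>x y. cinner (T x) y = cinner x (S y))"

lemma cadj_eqI:
  assumes "\<And>x y. cinner (T x) y = cinner x (S y)"
  shows "cadj T = S"
  unfolding cadj_def
proof (rule the_equality)
  fix S' assume S': "\<forall>x y. cinner (T x) y = cinner x (S' y)"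
  show "S' = S"
  proof
    fix y
    have "cinner (S' y) x = cinner (S y) x" for x
      using S' assms[of x y] cinner_commute[of "S' y" x] cinner_commute[of "S y" x] by simp
    then show "S' y = S y" by (rule cinner_ext)
  qed
qed (use assms in blast)

lemma minimal_norm_orthogonal:
  fixes z k :: "'a::chilbert_space"
  assumes min: "\<And>c. norm z \<le> norm (z + c *\<^sub>C k)"
  shows "cinner k z = 0"
proof (cases "k = 0")
  case False
  define n where "n = (norm k)\<^sup>2"
  have n: "n > 0" using False by (simp add: n_def)
  define c where "c = - cinner z k / complex_of_real n"
  have "cinner z (c *\<^sub>C k) = - complex_of_real ((cmod (cinner z k))\<^sup>2 / n)"
    by (simp add: c_def cinner_scaleC_right complex_norm_square mult.commute del: of_real_power)
  then have "Re (cinner z (c *\<^sub>C k)) = - (cmod (cinner z k))\<^sup>2 / n"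
    by simp
  moreover have "(norm (c *\<^sub>C k))\<^sup>2 = (cmod (cinner z k))\<^sup>2 / n"
  proof -
    have "cmod c = cmod (cinner z k) / n"
      using n by (simp add: c_def norm_divide)
    then have "(norm (c *\<^sub>C k))\<^sup>2 = (cmod (cinner z k) / n)\<^sup>2 * n"
      by (simp only: norm_scaleC power_mult_distrib n_def)
    then show ?thesis using n by (simp add: power2_eq_square)
  qed
  ultimately have "(norm (z + c *\<^sub>C k))\<^sup>2 = (norm z)\<^sup>2 - (cmod (cinner z k))\<^sup>2 / n"
    by (simp add: norm_add_sq)
  moreover have "(norm z)\<^sup>2 \<le> (norm (z + c *\<^sub>C k))\<^sup>2"
    using min[of c] by (simp add: power_mono)
  ultimately have "(cmod (cinner z k))\<^sup>2 / n \<le> 0" by simp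
  then have "cinner z k = 0" using n by (simp add: divide_le_0_iff)
  then show ?thesis using cinner_commute[of k z] by simp
qed simp

lemma riesz:
  fixes f :: "'a::chilbert_space \<Rightarrow> complex"
  assumes f: "bounded_linear f" and fC: "\<And>c x. f (c *\<^sub>C x) = c * f x"
  obtains z where "\<And>x. f x = cinner x z"
proof (cases "\<forall>x. f x = 0")
  case True
  then have "f x = cinner x 0" for x by simp
  then show ?thesis by (rule that)
next
  case False
  interpret f: bounded_linear f by (rule f)
  define A where "A = {x. f x = 1}"
  define d where "d = (INF x\<in>A. norm x)"
  from False obtain x0 where "f x0 \<noteq> 0" by blast
  then have "(1 / f x0) *\<^sub>C x0 \<in> A" by (simp add: A_def fC)
  then have A: "A \<noteq> {}" by blast
  have bdd: "bdd_below (norm ` A)" by (rule bdd_belowI2[of _ 0]) simp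
  have d_le: "d \<le> norm x" if "x \<in> A" for x
    unfolding d_def using that bdd by (rule cINF_lower[rotated])
  have d0: "0 \<le> d" unfolding d_def using A by (intro cINF_greatest) auto
  have "\<exists>x\<in>A. norm x < d + 1 / real (Suc n)" for n
  proof -
    have "(INF x\<in>A. norm x) < d + 1 / real (Suc n)" by (simp add: d_def)
    then show ?thesis using cINF_less_iff[OF A bdd] by blast
  qed
  then obtain X where X: "\<And>n. X n \<in> A" "\<And>n. norm (X n) < d + 1 / real (Suc n)" by metis
  have lim: "(\<lambda>n. d + 1 / real (Suc n)) \<longlonglongrightarrow> d"
    using tendsto_add[OF tendsto_const[of d] LIMSEQ_inverse_real_of_nat] by (simp add: inverse_eq_divide)
  define E where "E = (\<lambda>n. (d + 1 / real (Suc n))\<^sup>2 - d\<^sup>2)"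
  have E: "E \<longlonglongrightarrow> 0"
    using tendsto_diff[OF tendsto_power[OF lim, of 2] tendsto_const[of "d\<^sup>2"]] by (simp add: E_def)
  have XE: "(norm (X m - X n))\<^sup>2 \<le> 2 * E m + 2 * E n" for m n
  proof -
    have "(1/2) *\<^sub>R (X m + X n) \<in> A"
      using X(1)[of m] X(1)[of n] by (simp add: A_def f.scaleR f.add complex_eq_iff)
    from d_le[OF this] have "2 * d \<le> norm (X m + X n)" by simp
    then have "(2 * d)\<^sup>2 \<le> (norm (X m + X n))\<^sup>2" using d0 by (intro power_mono) auto
    then have 1: "4 * d\<^sup>2 \<le> (norm (X m + X n))\<^sup>2" by (simp add: power_mult_distrib)
    have 2: "(norm (X k))\<^sup>2 \<le> (d + 1 / real (Suc k))\<^sup>2" for k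
      using X(2)[of k] by (intro power_mono) auto
    show ?thesis using parallelogram[of "X m" "X n"] 1 2[of m] 2[of n] by (simp add: E_def)
  qed
  have "Cauchy X"
  proof (rule metric_CauchyI)
    fix e :: real assume e: "0 < e"
    then have "eventually (\<lambda>n. E n < e\<^sup>2 / 4) sequentially"
      using order_tendstoD(2)[OF E, of "e\<^sup>2 / 4"] by simp
    then obtain N where N: "\<And>n. n \<ge> N \<Longrightarrow> E n < e\<^sup>2 / 4"
      by (auto simp: eventually_sequentially)
    have "dist (X m) (X n) < e" if "m \<ge> N" "n \<ge> N" for m n
    proof -
      have "(norm (X m - X n))\<^sup>2 < e\<^sup>2" using XE[of m n] N[OF that(1)] N[OF that(2)] by linarith
      then show ?thesis using e by (simp add: dist_norm power_less_imp_less_base)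
    qed
    then show "\<exists>N. \<forall>m\<ge>N. \<forall>n\<ge>N. dist (X m) (X n) < e" by blast
  qed
  then obtain z where z: "X \<longlonglongrightarrow> z" by (auto simp: Cauchy_convergent_iff convergent_def)
  have "(\<lambda>n. f (X n)) \<longlonglongrightarrow> f z" by (rule f.tendsto[OF z])
  moreover have "(\<lambda>n. f (X n)) = (\<lambda>n. 1)" using X(1) by (simp add: A_def)
  ultimately have fz: "f z = 1" by (simp add: LIMSEQ_const_iff)
  have "norm z \<le> d"
    by (rule LIMSEQ_le[OF tendsto_norm[OF z] lim]) (use X(2) less_imp_le in blast)
  have orth: "cinner k z = 0" if "f k = 0" for k
  proof (rule minimal_norm_orthogonal)
    fix c
    have "z + c *\<^sub>C k \<in> A" using that fz by (simp add: A_def f.add fC)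
    then show "norm z \<le> norm (z + c *\<^sub>C k)" using d_le \<open>norm z \<le> d\<close> by force
  qed
  have z0: "z \<noteq> 0" using fz f.zero by auto
  have "f x = cinner x ((1 / complex_of_real ((norm z)\<^sup>2)) *\<^sub>C z)" for x
  proof -
    have "f (x - f x *\<^sub>C z) = 0" by (simp add: f.diff fC fz)
    from orth[OF this] have "cinner x z = f x * complex_of_real ((norm z)\<^sup>2)"
      by (simp add: cinner_diff_left cinner_scaleC_left cinner_norm)
    then show ?thesis using z0 by (simp add: cinner_scaleC_right)
  qed
  then show ?thesis by (rule that)
qed

lemma cadj_works:
  assumes T: "bounded_clinear T"
  shows "cinner (T x) y = cinner x (cadj T y)"
proof -
  have "\<exists>z. \<forall>x. cinner (T x) y = cinner x z" for y
  proof -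
    from T interpret T: bounded_linear T by (simp add: bounded_clinear_def)
    obtain K where K: "\<And>x. norm (T x) \<le> norm x * K" using T.bounded by blast
    have "bounded_linear (\<lambda>x. cinner (T x) y)"
    proof (rule bounded_linear_intro)
      show "cinner (T (x + x')) y = cinner (T x) y + cinner (T x') y" for x x'
        by (simp add: T.add cinner_add_left)
      show "cinner (T (r *\<^sub>R x)) y = r *\<^sub>R cinner (T x) y" for r x
        by (simp only: T.scaleR) (simp only: scaleR_scaleC cinner_scaleC_left scaleR_conv_of_real)
      show "norm (cinner (T x) y) \<le> norm x * (K * norm y)" for x
        using cinner_cauchy_schwarz[of "T x" y] mult_right_mono[OF K[of x] norm_ge_zero[of y]]
        by (simp add: mult_ac)
    qed
    moreover have "cinner (T (c *\<^sub>C x)) y = c * cinner (T x) y" for c x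
      using T by (simp add: bounded_clinear_def cinner_scaleC_left)
    ultimately show ?thesis
      by (rule riesz[of "\<lambda>x. cinner (T x) y"]) blast
  qed
  then obtain S where "\<And>x y. cinner (T x) y = cinner x (S y)" by metis
  then show ?thesis using cadj_eqI[of T S] by simp
qed

definition normal_op :: "('a::chilbert_space \<Rightarrow> 'a) \<Rightarrow> bool" where
  "normal_op N \<longleftrightarrow> bounded_clinear N \<and> cadj N \<circ> N = N \<circ> cadj N"

definition commutator :: "('a::chilbert_space \<Rightarrow> 'a) \<Rightarrow> ('a \<Rightarrow> 'a) \<Rightarrow> 'a \<Rightarrow> 'a" where
  "commutator S T = (\<lambda>x. S (T x) - T (S x))"

text \<open>The second conjunct says that the operator matrix
  \<open>([T1*,T1], [T2*,T1]; [T1*,T2], [T2*,T2])\<close> acting on \<open>H \<oplus> H\<close> is positive.\<close>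

definition hyponormal_pair :: "('a::chilbert_space \<Rightarrow> 'a) \<Rightarrow> ('a \<Rightarrow> 'a) \<Rightarrow> bool" where
  "hyponormal_pair T1 T2 \<longleftrightarrow>
     T1 \<circ> T2 = T2 \<circ> T1 \<and>
     (\<forall>x y. cinner (commutator (cadj T1) T1 x + commutator (cadj T2) T1 y) x
          + cinner (commutator (cadj T1) T2 x + commutator (cadj T2) T2 y) y \<in> \<real>\<^sub>\<ge>\<^sub>0)"

definition isometric_embedding :: "('a::chilbert_space \<Rightarrow> 'b::chilbert_space) \<Rightarrow> bool" where
  "isometric_embedding V \<longleftrightarrow> bounded_clinear V \<and> (\<forall>x. norm (V x) = norm x)"

text \<open>The Hilbert space \<open>H\<close> is regarded as a closed subspace of the larger Hilbert space \<open>K\<close> by means of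
  an isometry \<open>V\<close>.  Then \<open>N \<circ> V = V \<circ> T\<close> says both that \<open>H\<close> is invariant under \<open>N\<close> and that \<open>T\<close> is
  the restriction of \<open>N\<close> to \<open>H\<close>.  As one cannot quantify over types inside a formula, \<open>K\<close> is a type
  parameter.  A theorem with hypothesis \<open>subnormal_op TYPE('k) T\<close> for a type variable \<open>'k\<close>
  covers every operator \<open>T\<close> having a normal extension on any Hilbert space whatsoever; a conclusion
  \<open>\<not> subnormal_pair TYPE('k) T1 T2\<close> for a type variable \<open>'k\<close> says that
  there is no commuting normal extension on any Hilbert space.\<close>

definition subnormal_op :: "'k::chilbert_space itself \<Rightarrow> ('a::chilbert_space \<Rightarrow> 'a) \<Rightarrow> bool" where
  "subnormal_op _ T \<longleftrightarrow>
     (\<exists>(V :: 'a \<Rightarrow> 'k) N. isometric_embedding V \<and> normal_op N \<and> N \<circ> V = V \<circ> T)"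

definition subnormal_pair ::
  "'k::chilbert_space itself \<Rightarrow> ('a::chilbert_space \<Rightarrow> 'a) \<Rightarrow> ('a \<Rightarrow> 'a) \<Rightarrow> bool" where
  "subnormal_pair _ T1 T2 \<longleftrightarrow>
     T1 \<circ> T2 = T2 \<circ> T1 \<and>
     (\<exists>(V :: 'a \<Rightarrow> 'k) N1 N2. isometric_embedding V \<and> normal_op N1 \<and> normal_op N2 \<and>
        N1 \<circ> N2 = N2 \<circ> N1 \<and> N1 \<circ> V = V \<circ> T1 \<and> N2 \<circ> V = V \<circ> T2)"

text \<open>The operator \<open>e\<^sub>k \<mapsto> w\<^sub>k e\<^bsub>s k\<^esub>\<close> on \<open>\<ell>\<^sup>2(I)\<close>, for an injective map \<open>s\<close> and a bounded family of
  weights \<open>w\<close>; outside this case the definition is meaningless.\<close>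

definition shift_op :: "('i \<Rightarrow> 'i) \<Rightarrow> ('i \<Rightarrow> real) \<Rightarrow> 'i ell2 \<Rightarrow> 'i ell2" where
  "shift_op s w f =
     Abs_ell2 (\<lambda>j. if j \<in> range s then complex_of_real (w (inv s j)) * coord f (inv s j) else 0)"

lemma
  assumes s: "inj s" and w: "bounded (range w)"
  shows coord_shift_op: "coord (shift_op s w f) j =
      (if j \<in> range s then complex_of_real (w (inv s j)) * coord f (inv s j) else 0)" (is ?A)
    and bounded_clinear_shift_op: "bounded_clinear (shift_op s w)" (is ?B)
    and shift_op_ket: "shift_op s w (ket k) = w k *\<^sub>R ket (s k)" (is ?C)
proof -
  obtain B where B: "\<And>k. \<bar>w k\<bar> \<le> B" "0 \<le> B"
    using w unfolding bounded_iff by (metis abs_ge_zero order_trans rangeI real_norm_def)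
  let ?g = "\<lambda>f j. if j \<in> range s then complex_of_real (w (inv s j)) * coord f (inv s j) else 0"
  have L2: "L2_set (\<lambda>j. cmod (?g f j)) F \<le> B * norm f" if "finite F" for f F
  proof -
    have "(\<Sum>j\<in>F. (cmod (?g f j))\<^sup>2) = (\<Sum>j\<in>F \<inter> range s. (cmod (?g f j))\<^sup>2)"
      by (rule sum.mono_neutral_right) (use that in auto)
    also have "\<dots> = (\<Sum>k\<in>s -` F. (cmod (?g f (s k)))\<^sup>2)"
      by (subst image_vimage_eq[symmetric], subst sum.reindex) (use s in \<open>auto simp: inj_on_def\<close>)
    also have "\<dots> = (\<Sum>k\<in>s -` F. (cmod (w k * coord f k))\<^sup>2)"
      using s by simp
    also have "\<dots> \<le> (\<Sum>k\<in>s -` F. (B * cmod (coord f k))\<^sup>2)"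
      using B by (intro sum_mono power_mono) (auto simp: norm_mult intro: mult_right_mono)
    finally have "L2_set (\<lambda>j. cmod (?g f j)) F \<le> L2_set (\<lambda>k. B * cmod (coord f k)) (s -` F)"
      by (simp add: L2_set_def)
    also have "\<dots> = B * L2_set (\<lambda>k. cmod (coord f k)) (s -` F)"
      using B by (simp add: L2_set_right_distrib)
    also have "\<dots> \<le> B * norm f"
      using B L2_set_le_norm[of "s -` F" f] finite_vimageI[OF that s] by (simp add: mult_left_mono)
    finally show ?thesis .
  qed
  have "(\<lambda>j. (cmod (?g f j))\<^sup>2) summable_on UNIV" for f
    by (rule ell2_finite_bound) (rule L2)
  then have co: "coord (shift_op s w f) = ?g f" for f
    by (simp add: shift_op_def Abs_ell2_inverse)
  then show ?A by simp
  have "norm (shift_op s w f) \<le> norm f * B" for f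
    by (rule norm_ell2_le) (use L2 B in \<open>simp_all add: co mult.commute\<close>)
  then have "bounded_linear (shift_op s w)"
    by (intro bounded_linear_intro[where K = B] ell2_eqI)
       (auto simp: co plus_ell2.rep_eq scaleR_scaleC scaleC_ell2.rep_eq algebra_simps)
  then show ?B
    unfolding bounded_clinear_def by (auto intro!: ell2_eqI simp: co scaleC_ell2.rep_eq)
  show ?C
    by (rule ell2_eqI) (use s in \<open>auto simp: co coord_ket scaleR_scaleC scaleC_ell2.rep_eq inj_eq\<close>)
qed

definition T1_of :: "(nat \<times> nat \<Rightarrow> real) \<Rightarrow> (nat \<times> nat) ell2 \<Rightarrow> (nat \<times> nat) ell2" where
  "T1_of \<alpha> = shift_op (\<lambda>(i, j). (Suc i, j)) \<alpha>"

definition T2_of :: "(nat \<times> nat \<Rightarrow> real) \<Rightarrow> (nat \<times> nat) ell2 \<Rightarrow> (nat \<times> nat) ell2" where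
  "T2_of \<beta> = shift_op (\<lambda>(i, j). (i, Suc j)) \<beta>"

definition commuting_weights :: "(nat \<times> nat \<Rightarrow> real) \<Rightarrow> (nat \<times> nat \<Rightarrow> real) \<Rightarrow> bool" where
  "commuting_weights \<alpha> \<beta> \<longleftrightarrow>
     bounded (range \<alpha>) \<and> bounded (range \<beta>) \<and> (\<forall>k. 0 < \<alpha> k) \<and> (\<forall>k. 0 < \<beta> k) \<and>
     (\<forall>i j. \<beta> (Suc i, j) * \<alpha> (i, j) = \<alpha> (i, Suc j) * \<beta> (i, j))"

text \<open>The class \<open>\<S>\<F>\<C>\<close>; the two type parameters are the Hilbert spaces carrying the normal extensions of
  the coordinate operators.\<close>

definition SFC :: "'k1::chilbert_space itself \<Rightarrow> 'k2::chilbert_space itself \<Rightarrow>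
    (nat \<times> nat \<Rightarrow> real) \<Rightarrow> (nat \<times> nat \<Rightarrow> real) \<Rightarrow> bool" where
  "SFC K1 K2 \<alpha> \<beta> \<longleftrightarrow>
     commuting_weights \<alpha> \<beta> \<and>
     (\<forall>i\<ge>1. \<forall>j\<ge>1. \<alpha> (i, j) = 1 \<and> \<beta> (i, j) = 1) \<and>
     onorm (T1_of \<alpha>) \<le> 1 \<and> onorm (T2_of \<beta>) \<le> 1 \<and>
     subnormal_op K1 (T1_of \<alpha>) \<and> subnormal_op K2 (T2_of \<beta>)"

definition borel_prob :: "real measure \<Rightarrow> bool" where
  "borel_prob \<mu> \<longleftrightarrow> prob_space \<mu> \<and> sets \<mu> = sets borel"

definition berger_measure :: "(nat \<Rightarrow> real) \<Rightarrow> real measure \<Rightarrow> bool" where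
  "berger_measure \<omega> \<mu> \<longleftrightarrow>
     borel_prob \<mu> \<and> (\<exists>C. AE t in \<mu>. t \<in> {0..C}) \<and>
     (\<forall>k\<ge>1. (\<Prod>i<k. (\<omega> i)\<^sup>2) = (\<integral>t. t ^ k \<partial>\<mu>))"

text \<open>\<open>\<mu> = p \<delta>\<^sub>0 + q \<delta>\<^sub>1 + [1 - (p + q)] \<rho>\<close>\<close>

definition two_atom_mixture :: "real \<Rightarrow> real \<Rightarrow> real measure \<Rightarrow> real measure \<Rightarrow> bool" where
  "two_atom_mixture p q \<rho> \<mu> \<longleftrightarrow>
     (\<forall>A\<in>sets borel. measure \<mu> A =
        p * measure (return borel 0) A + q * measure (return borel 1) A + (1 - (p + q)) * measure \<rho> A)"

text \<open>Below, \<open>L1_norm \<mu> (\<lambda>t. 1 / t)\<close> is only used for the Berger measure \<open>\<mu>\<close> of \<open>shift(y\<^sub>1, y\<^sub>2, \<dots>)\<close> when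
  \<open>shift(y\<^sub>0, y\<^sub>1, \<dots>)\<close> has a Berger measure \<open>\<eta>\<close> too.  Then \<open>y\<^sub>0\<^sup>2 d\<mu>(t) = t d\<eta>(t)\<close>, so that \<open>\<mu>({0}) = 0\<close> and
  \<open>1 / t\<close> is \<open>\<mu>\<close>-integrable; the conventions \<open>1 / 0 = 0\<close> and \<open>integral = 0\<close> for
  nonintegrable functions play no role.\<close>

definition L1_norm :: "'a measure \<Rightarrow> ('a \<Rightarrow> real) \<Rightarrow> real" where
  "L1_norm \<mu> f = (\<integral>t. \<bar>f t\<bar> \<partial>\<mu>)"

end

theory Submission
  imports Defs
begin

text \<open>
  Every quantity in the theorem is a statement about the atoms of \<open>\<xi>\<close> and \<open>\<eta>\<close> at \<open>0\<close> and \<open>1\<close> and about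
  \<open>c\<^sup>2\<close>, where \<open>c = a y\<^sub>0 = \<parallel>T\<^sub>1\<^sup>i T\<^sub>2\<^sup>j e\<^bsub>(0,0)\<^esub>\<parallel>\<close> for all \<open>i, j \<ge> 1\<close>.  If the pair had a two-variable Berger
  measure \<open>\<mu>\<close>, then \<open>st d\<mu>\<close> would be the point mass \<open>c\<^sup>2\<close> at \<open>(1,1)\<close>, so \<open>\<mu>\<close> would consist of
  this atom and of parts on the two axes, which have masses \<open>u\<close> and \<open>p\<close>.  Counting mass gives
  \<open>1 \<le> p + u + c\<^sup>2\<close>.  Contractivity forces \<open>c\<^sup>2 \<le> q\<close> and \<open>c\<^sup>2 \<le> v\<close>, that is, \<open>y\<^sub>0\<close> never exceeds the first
  term of the minimum \<open>s\<close>; and \<open>\<parallel>1/t\<parallel> = (1 - u) / y\<^sub>0\<^sup>2\<close>, so that \<open>y\<^sub>0\<close> exceeding the second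
  term says exactly \<open>p + u + c\<^sup>2 < 1\<close>.

  \<^bold>\<open>Not subnormal.\<close>  The mass count is carried out inside the extension space
  (\<open>commuting_normal_kernel_bound\<close>), with the orthogonal projections onto \<open>ker N\<^sub>1\<close> and \<open>ker N\<^sub>2\<close> in the
  roles of the indicator functions of the axes.  An operator that commutes with a normal \<open>N\<close> leaves both
  \<open>ker N\<close> and its orthogonal complement invariant, by elementary algebra, so the two projections
  commute.  The squared length of the projection of \<open>e\<^bsub>(0,0)\<^esub>\<close> onto
  \<open>ker N\<close> is compared with the atom at \<open>0\<close> by applying powers of \<open>1 - N\<^sup>*N\<close>
  (\<open>norm_kernel_part_le\<close>).

  \<^bold>\<open>Hyponormal.\<close>  Hyponormality follows when a \<open>2 \<times> 2\<close> matrix is positive at every lattice point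
  (\<open>six_point_test\<close>).  In the flat region the matrix vanishes.  On the axes its determinant condition is
  the positivity of a Hankel determinant of \<open>\<xi> - c\<^sup>2 \<delta>\<^sub>1\<close> or \<open>\<eta> - c\<^sup>2 \<delta>\<^sub>1\<close>, and these
  are positive measures because \<open>c\<^sup>2 \<le> q\<close> and \<open>c\<^sup>2 \<le> v\<close>.  At the origin it is \<open>y\<^sub>0 \<le> h\<close>.

  \<^bold>\<open>The interval is nonempty.\<close>  The Cauchy-Schwarz inequality for \<open>\<eta> - c\<^sup>2 \<delta>\<^sub>1\<close> bounds \<open>y\<^sub>1\<close> from below in terms
  of \<open>\<parallel>1/t\<parallel>\<close>.  What remains is an inequality for the mean and the second moment of a measure with
  atoms \<open>p\<close>, \<open>q\<close> at \<open>0\<close>, \<open>1\<close> and the remaining mass \<open>1 - p - q > 0\<close> in between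
  (\<open>min_less_ratio\<close>); it is strict because that mass is positive.
\<close>

section \<open>Kernels of commuting normal operators\<close>

lemma bounded_clinear_diff:
  assumes "bounded_clinear N"
  shows "N (x - y) = N x - N y"
  using assms by (simp add: bounded_clinear_def bounded_linear.linear linear_diff)

lemma bounded_clinear_scaleR:
  assumes "bounded_clinear N"
  shows "N (r *\<^sub>R x) = r *\<^sub>R N x"
  using assms by (simp add: bounded_clinear_def bounded_linear.linear linear_scale)

lemma bounded_clinear_zero:
  assumes "bounded_clinear N"
  shows "N 0 = 0"
  using assms by (simp add: bounded_clinear_def bounded_linear.linear linear_0)

lemma bounded_clinear_funpow_diff:
  fixes N :: "'a::chilbert_space \<Rightarrow> 'a"
  assumes "bounded_clinear N"
  shows "(N ^^ n) (x - y) = (N ^^ n) x - (N ^^ n) y"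
  by (induction n) (simp_all add: bounded_clinear_diff[OF assms])

lemma cadj_works':
  assumes "bounded_clinear T"
  shows "cinner (cadj T x) y = cinner x (T y)"
  by (metis assms cadj_works cinner_commute)

lemma cadj_diff:
  assumes "bounded_clinear T"
  shows "cadj T (x - y) = cadj T x - cadj T y"
  by (rule cinner_ext) (simp add: cinner_diff_left cadj_works'[OF assms])

lemma norm_sq_cinner: "(norm x)\<^sup>2 = Re (cinner x x)"
  by (simp add: cinner_norm)

lemma pythagoras:
  assumes "cinner x y = 0"
  shows "(norm (x + y))\<^sup>2 = (norm x)\<^sup>2 + (norm y)\<^sup>2"
  using assms by (simp add: norm_add_sq)

text \<open>The projection theorem for the closed subspace \<open>ker N\<close>: a minimising sequence in the affine
  space \<open>f + ker N\<close> is Cauchy by the parallelogram law, and the vector of least norm is orthogonal to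
  \<open>ker N\<close>.\<close>

lemma kernel_projection:
  fixes N :: "'a::chilbert_space \<Rightarrow> 'a"
  assumes N: "bounded_clinear N"
  obtains k where "N k = 0" "\<And>k'. N k' = 0 \<Longrightarrow> cinner k' (f - k) = 0"
proof -
  interpret N: bounded_linear N using N by (simp add: bounded_clinear_def)
  define A where "A = (\<lambda>k. f - k) ` {k. N k = 0}"
  define d where "d = (INF z\<in>A. norm z)"
  have A: "A \<noteq> {}" unfolding A_def using N.zero by blast
  have bdd: "bdd_below (norm ` A)" by (rule bdd_belowI2[of _ 0]) simp
  have d_le: "d \<le> norm z" if "z \<in> A" for z
    unfolding d_def using that bdd by (rule cINF_lower[rotated])
  have d0: "0 \<le> d" unfolding d_def using A by (intro cINF_greatest) auto
  have "\<exists>z\<in>A. norm z < d + 1 / real (Suc n)" for n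
  proof -
    have "(INF z\<in>A. norm z) < d + 1 / real (Suc n)" by (simp add: d_def)
    then show ?thesis using cINF_less_iff[OF A bdd] by blast
  qed
  then obtain X where X: "\<And>n. X n \<in> A" "\<And>n. norm (X n) < d + 1 / real (Suc n)" by metis
  have lim: "(\<lambda>n. d + 1 / real (Suc n)) \<longlonglongrightarrow> d"
    using tendsto_add[OF tendsto_const[of d] LIMSEQ_inverse_real_of_nat] by (simp add: inverse_eq_divide)
  define E where "E = (\<lambda>n. (d + 1 / real (Suc n))\<^sup>2 - d\<^sup>2)"
  have E: "E \<longlonglongrightarrow> 0"
    using tendsto_diff[OF tendsto_power[OF lim, of 2] tendsto_const[of "d\<^sup>2"]] by (simp add: E_def)
  have mid: "(1/2) *\<^sub>R (z + w) \<in> A" if "z \<in> A" "w \<in> A" for z w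
  proof -
    from that obtain k l where kl: "N k = 0" "N l = 0" "z = f - k" "w = f - l" by (auto simp: A_def)
    have "(1/2) *\<^sub>R (z + w) = f - (1/2) *\<^sub>R (k + l)"
      by (simp add: kl algebra_simps flip: scaleR_left_distrib)
    moreover have "N ((1/2) *\<^sub>R (k + l)) = 0" by (simp add: N.scaleR N.add kl)
    ultimately show ?thesis by (auto simp: A_def)
  qed
  have XE: "(norm (X m - X n))\<^sup>2 \<le> 2 * E m + 2 * E n" for m n
  proof -
    from d_le[OF mid[OF X(1)[of m] X(1)[of n]]] have "2 * d \<le> norm (X m + X n)" by simp
    then have "(2 * d)\<^sup>2 \<le> (norm (X m + X n))\<^sup>2" using d0 by (intro power_mono) auto
    then have 1: "4 * d\<^sup>2 \<le> (norm (X m + X n))\<^sup>2" by (simp add: power_mult_distrib)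
    have 2: "(norm (X k))\<^sup>2 \<le> (d + 1 / real (Suc k))\<^sup>2" for k
      using X(2)[of k] by (intro power_mono) auto
    show ?thesis using parallelogram[of "X m" "X n"] 1 2[of m] 2[of n] by (simp add: E_def)
  qed
  have "Cauchy X"
  proof (rule metric_CauchyI)
    fix e :: real assume e: "0 < e"
    then have "eventually (\<lambda>n. E n < e\<^sup>2 / 4) sequentially"
      using order_tendstoD(2)[OF E, of "e\<^sup>2 / 4"] by simp
    then obtain N where N: "\<And>n. n \<ge> N \<Longrightarrow> E n < e\<^sup>2 / 4"
      by (auto simp: eventually_sequentially)
    have "dist (X m) (X n) < e" if "m \<ge> N" "n \<ge> N" for m n
    proof -
      have "(norm (X m - X n))\<^sup>2 < e\<^sup>2" using XE[of m n] N[OF that(1)] N[OF that(2)] by linarith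
      then show ?thesis using e by (simp add: dist_norm power_less_imp_less_base)
    qed
    then show "\<exists>N. \<forall>m\<ge>N. \<forall>n\<ge>N. dist (X m) (X n) < e" by blast
  qed
  then obtain z where z: "X \<longlonglongrightarrow> z" by (auto simp: Cauchy_convergent_iff convergent_def)
  have "(\<lambda>n. N (X n)) \<longlonglongrightarrow> N z" by (rule N.tendsto[OF z])
  moreover have "N (X n) = N f" for n using X(1)[of n] by (auto simp: A_def N.diff)
  ultimately have Nz: "N z = N f" by (simp add: LIMSEQ_const_iff)
  have "norm z \<le> d"
    by (rule LIMSEQ_le[OF tendsto_norm[OF z] lim]) (use X(2) less_imp_le in blast)
  show ?thesis
  proof (rule that[of "f - z"])
    show "N (f - z) = 0" by (simp add: N.diff Nz)
    fix k assume k: "N k = 0"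
    have "cinner k z = 0"
    proof (rule minimal_norm_orthogonal)
      fix c
      have "N (f - z - c *\<^sub>C k) = 0"
        using N k minus_scaleC[of "0::'a"] by (simp add: N.diff Nz bounded_clinear_def) (metis add.left_neutral add_cancel_right_right scaleC_add_right)
      moreover have "z + c *\<^sub>C k = f - (f - z - c *\<^sub>C k)" by simp
      ultimately have "z + c *\<^sub>C k \<in> A" unfolding A_def by blast
      then show "norm z \<le> norm (z + c *\<^sub>C k)" using d_le \<open>norm z \<le> d\<close> by force
    qed
    then show "cinner k (f - (f - z)) = 0" by simp
  qed
qed

context
  fixes N :: "'a::chilbert_space \<Rightarrow> 'a"
  assumes N: "normal_op N"
begin

lemma normal_bounded: "bounded_clinear N"
  using N by (simp add: normal_op_def)

lemma normal_commute: "cadj N (N x) = N (cadj N x)"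
  using N by (metis comp_apply normal_op_def)

lemma norm_cadj_normal: "norm (cadj N x) = norm (N x)"
proof -
  have "cinner (cadj N x) (cadj N x) = cinner (N x) (N x)"
    by (simp add: cadj_works'[OF normal_bounded] cadj_works[OF normal_bounded] flip: normal_commute)
  then have "(norm (cadj N x))\<^sup>2 = (norm (N x))\<^sup>2" by (simp add: norm_sq_cinner)
  then show ?thesis by simp
qed

text \<open>For normal \<open>N\<close> this is the integral of \<open>(1 - t)\<^sup>2 = 1 - 2t + t\<^sup>2\<close> in terms of the moments
  \<open>\<parallel>N\<^sup>k x\<parallel>\<^sup>2\<close>.\<close>

lemma norm_defect:
  "(norm (x - cadj N (N x)))\<^sup>2 = (norm x)\<^sup>2 - 2 * (norm (N x))\<^sup>2 + (norm (N (N x)))\<^sup>2"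
  using norm_add_sq[of x "- cadj N (N x)"]
  by (simp add: cinner_minus_right cadj_works[OF normal_bounded, symmetric] cinner_norm norm_cadj_normal)

text \<open>The three equal norms make \<open>N\<close> isometric in the sense \<open>N\<^sup>*N z = z\<close> at \<open>z = N x\<close>, and off the kernel
  \<open>N\<close> can be cancelled from \<open>N (N\<^sup>*N x) = N x\<close>.  In spectral terms: a measure on \<open>(0,\<infinity>)\<close> whose moments of order
  \<open>1\<close>, \<open>2\<close>, \<open>3\<close> coincide is carried by \<open>{1}\<close>, so its mass is that moment.\<close>

lemma norm_eq_of_perp_kernel:
  assumes perp: "\<And>k. N k = 0 \<Longrightarrow> cinner k x = 0"
    and eq: "norm (N (N x)) = norm (N x)" "norm (N (N (N x))) = norm (N x)"
  shows "norm x = norm (N x)"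
proof -
  have "(norm (N x - cadj N (N (N x))))\<^sup>2 = 0"
    unfolding norm_defect using eq by simp
  then have "N (x - cadj N (N x)) = 0"
    using normal_commute[of "N x"] by (simp add: bounded_clinear_diff[OF normal_bounded])
  moreover from this have "cinner (x - cadj N (N x)) (cadj N (N x)) = 0"
    by (simp add: cadj_works[OF normal_bounded, symmetric])
  ultimately have "cinner (x - cadj N (N x)) (x - cadj N (N x)) = 0"
    using perp by (simp add: cinner_diff_right)
  then have "x = cadj N (N x)" by (simp add: cinner_norm)
  then have "cinner x x = cinner x (cadj N (N x))" by (rule arg_cong[where f = "cinner x"])
  also have "\<dots> = cinner (N x) (N x)" by (simp add: cadj_works[OF normal_bounded])
  finally have "(norm x)\<^sup>2 = (norm (N x))\<^sup>2" by (simp add: norm_sq_cinner)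
  then show ?thesis by simp
qed

text \<open>Taking adjoints, \<open>M\<^sup>*\<close> commutes with \<open>N\<^sup>*\<close> and so leaves \<open>ker N\<^sup>*\<close> invariant, which is \<open>ker N\<close> because \<open>N\<close> is
  normal.\<close>

lemma kernel_perp_invariant:
  assumes M: "bounded_clinear M" and MN: "\<And>z. M (N z) = N (M z)"
    and perp: "\<And>k. N k = 0 \<Longrightarrow> cinner k x = 0" and k: "N k = 0"
  shows "cinner k (M x) = 0"
proof -
  have "cadj N (cadj M k) = cadj M (cadj N k)"
    by (rule cinner_ext) (simp add: cadj_works'[OF normal_bounded] cadj_works'[OF M] MN)
  also have "cadj N k = 0" using norm_cadj_normal[of k] k by simp
  also have "cadj M 0 = 0" using cadj_diff[OF M, of 0 0] by simp
  finally have "N (cadj M k) = 0" using norm_cadj_normal[of "cadj M k"] by simp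
  then show ?thesis using perp by (simp add: cadj_works'[OF M, symmetric])
qed

definition defect :: "'a \<Rightarrow> 'a" where
  "defect x = x - cadj N (N x)"

text \<open>Weighted with \<open>t\<^sup>j\<close> the formula becomes inductive: \<open>1 - N\<^sup>*N\<close> commutes with \<open>N\<close>, and \<open>norm_defect\<close>
  turns one more factor of it into the factor \<open>(1 - t)\<^sup>2\<close> under the integral.\<close>

lemma norm_funpow_defect:
  fixes \<mu> :: "real measure"
  assumes int: "\<And>m j. integrable \<mu> (\<lambda>t. (1 - t) ^ m * t ^ j)"
    and mom: "\<And>j. (norm ((N ^^ j) f))\<^sup>2 = (\<integral>t. t ^ j \<partial>\<mu>)"
  shows "(norm ((N ^^ j) ((defect ^^ m) f)))\<^sup>2 = (\<integral>t. (1 - t) ^ (2 * m) * t ^ j \<partial>\<mu>)"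
proof (induction m arbitrary: j)
  case 0
  show ?case by (simp add: mom)
next
  case (Suc m)
  let ?z = "(defect ^^ m) f"
  have comm: "(N ^^ j) (defect z) = (N ^^ j) z - cadj N (N ((N ^^ j) z))" for j z
    by (induction j)
       (simp_all add: defect_def bounded_clinear_diff[OF normal_bounded] normal_commute)
  have "(norm ((N ^^ j) ((defect ^^ Suc m) f)))\<^sup>2
      = (norm ((N ^^ j) ?z))\<^sup>2 - 2 * (norm ((N ^^ Suc j) ?z))\<^sup>2 + (norm ((N ^^ Suc (Suc j)) ?z))\<^sup>2"
    by (simp add: comm norm_defect)
  also have "\<dots> = (\<integral>t. (1 - t) ^ (2 * m) * t ^ j - 2 * ((1 - t) ^ (2 * m) * t ^ Suc j)
      + (1 - t) ^ (2 * m) * t ^ Suc (Suc j) \<partial>\<mu>)"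
    unfolding Suc.IH using int[of "2 * m" j] int[of "2 * m" "Suc j"] int[of "2 * m" "Suc (Suc j)"] by simp
  also have "\<dots> = (\<integral>t. (1 - t) ^ (2 * Suc m) * t ^ j \<partial>\<mu>)"
    by (rule Bochner_Integration.integral_cong) (simp_all add: algebra_simps power2_eq_square)
  finally show ?case .
qed

text \<open>The operator \<open>1 - N\<^sup>*N\<close> fixes \<open>ker N\<close> and is symmetric, so its powers do not change the component of
  \<open>f\<close> along \<open>k\<close>.  As \<open>m \<rightarrow> \<infinity>\<close>, the right-hand side tends to the mass at \<open>0\<close> of a measure on the
  unit interval.\<close>

lemma norm_kernel_part_le:
  fixes \<mu> :: "real measure"
  assumes int: "\<And>m j. integrable \<mu> (\<lambda>t. (1 - t) ^ m * t ^ j)"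
    and mom: "\<And>j. (norm ((N ^^ j) f))\<^sup>2 = (\<integral>t. t ^ j \<partial>\<mu>)"
    and k: "N k = 0" "cinner k (f - k) = 0"
  shows "(norm k)\<^sup>2 \<le> (\<integral>t. (1 - t) ^ (2 * m) \<partial>\<mu>)"
proof -
  have "cinner k (defect z) = cinner k z" for z
    using k(1) by (simp add: defect_def cinner_diff_right cadj_works[OF normal_bounded, symmetric])
  then have "cinner k ((defect ^^ m) f) = cinner k f"
    by (induction m) simp_all
  also have "\<dots> = complex_of_real ((norm k)\<^sup>2)"
    using k(2) by (simp add: cinner_diff_right cinner_norm)
  finally have "cmod (cinner k ((defect ^^ m) f)) = (norm k)\<^sup>2" by (simp del: of_real_power)
  then have "norm k * norm k \<le> norm k * norm ((defect ^^ m) f)"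
    using cinner_cauchy_schwarz[of k "(defect ^^ m) f"] by (simp add: power2_eq_square)
  then have "norm k \<le> norm ((defect ^^ m) f)"
    by (cases "k = 0") (simp_all add: mult_le_cancel_left)
  then have "(norm k)\<^sup>2 \<le> (norm ((defect ^^ m) f))\<^sup>2" by (intro power_mono) auto
  also have "\<dots> = (\<integral>t. (1 - t) ^ (2 * m) \<partial>\<mu>)"
    using norm_funpow_defect[OF int mom, of 0 m] by simp
  finally show ?thesis .
qed

end

text \<open>If \<open>f\<close> had a joint spectral measure, then the part of it off the axes would be the point mass \<open>c\<^sup>2\<close> at
  \<open>(1,1)\<close>.  Here the vector \<open>g\<close>, the component of \<open>f\<close> orthogonal to both kernels, takes the place of this part: it has
  the same images as \<open>f\<close> under \<open>N\<^sub>1\<^sup>i N\<^sub>2\<^sup>j\<close> for \<open>i, j \<ge> 1\<close>, and two applications of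
  \<open>norm_eq_of_perp_kernel\<close>, first for \<open>N\<^sub>2\<close> and then for \<open>N\<^sub>1\<close>, show \<open>\<parallel>g\<parallel> = c\<close>.\<close>

lemma commuting_normal_kernel_bound:
  fixes N\<^sub>1 N\<^sub>2 :: "'a::chilbert_space \<Rightarrow> 'a"
  assumes N: "normal_op N\<^sub>1" "normal_op N\<^sub>2" and comm: "\<And>z. N\<^sub>1 (N\<^sub>2 z) = N\<^sub>2 (N\<^sub>1 z)"
    and c: "\<And>i j. i \<ge> 1 \<Longrightarrow> j \<ge> 1 \<Longrightarrow> norm ((N\<^sub>1 ^^ i) ((N\<^sub>2 ^^ j) f)) = c"
  obtains k\<^sub>1 k\<^sub>2 where "N\<^sub>1 k\<^sub>1 = 0" "cinner k\<^sub>1 (f - k\<^sub>1) = 0" "N\<^sub>2 k\<^sub>2 = 0" "cinner k\<^sub>2 (f - k\<^sub>2) = 0"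
    "(norm f)\<^sup>2 \<le> (norm k\<^sub>1)\<^sup>2 + (norm k\<^sub>2)\<^sup>2 + c\<^sup>2"
proof -
  note B = N[THEN normal_bounded]
  obtain k\<^sub>1 where k1: "N\<^sub>1 k\<^sub>1 = 0" "\<And>k. N\<^sub>1 k = 0 \<Longrightarrow> cinner k (f - k\<^sub>1) = 0"
    using kernel_projection[OF B(1)] by metis
  obtain k\<^sub>2 where k2: "N\<^sub>2 k\<^sub>2 = 0" "\<And>k. N\<^sub>2 k = 0 \<Longrightarrow> cinner k (f - k\<^sub>2) = 0"
    using kernel_projection[OF B(2)] by metis
  define r where "r = f - k\<^sub>1"
  obtain l where l: "N\<^sub>2 l = 0" "\<And>k. N\<^sub>2 k = 0 \<Longrightarrow> cinner k (r - l) = 0"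
    using kernel_projection[OF B(2)] by metis
  define g where "g = r - l"
  have r1: "cinner k r = 0" if "N\<^sub>1 k = 0" for k using k1(2)[OF that] by (simp add: r_def)
  have g2: "cinner k g = 0" if "N\<^sub>2 k = 0" for k using l(2)[OF that] by (simp add: g_def)
  have comm_pow: "N\<^sub>1 ((N\<^sub>2 ^^ j) z) = (N\<^sub>2 ^^ j) (N\<^sub>1 z)" "N\<^sub>2 ((N\<^sub>1 ^^ j) z) = (N\<^sub>1 ^^ j) (N\<^sub>2 z)" for j z
    by (induction j) (simp_all add: comm, simp add: comm[symmetric])
  \<comment> \<open>This says that the two kernel projections commute: \<open>m\<close>, the projection of \<open>k\<close> onto \<open>ker N\<^sub>2\<close>,
    stays in \<open>ker N\<^sub>1\<close>.\<close>
  have g1: "cinner k g = 0" if k: "N\<^sub>1 k = 0" for k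
  proof -
    obtain m where m: "N\<^sub>2 m = 0" "\<And>k'. N\<^sub>2 k' = 0 \<Longrightarrow> cinner k' (k - m) = 0"
      using kernel_projection[OF B(2)] by metis
    have "N\<^sub>1 (k - m) = - N\<^sub>1 m" using k by (simp add: bounded_clinear_diff[OF B(1)])
    moreover have ker: "N\<^sub>2 (N\<^sub>1 m) = 0" using m(1) comm[of m] bounded_clinear_zero[OF B(1)] by simp
    moreover have "cinner (N\<^sub>1 m) (N\<^sub>1 (k - m)) = 0"
      by (rule kernel_perp_invariant[OF N(2) B(1)]) (use comm m(2) ker in auto)
    ultimately have m1: "N\<^sub>1 m = 0" by (simp add: cinner_minus_right cinner_norm)
    have "cinner (k - m) l = 0" using m(2)[OF l(1)] cinner_commute[of "k - m" l] by simp
    then have "cinner (k - m) g = cinner (k - m) r" by (simp add: g_def cinner_diff_right)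
    also have "\<dots> = 0" using k m1 by (intro r1) (simp add: bounded_clinear_diff[OF B(1)])
    finally show ?thesis using g2[OF m(1)] by (simp add: cinner_diff_left)
  qed
  have powg: "(N\<^sub>1 ^^ i) ((N\<^sub>2 ^^ j) g) = (N\<^sub>1 ^^ i) ((N\<^sub>2 ^^ j) f)" if "i \<ge> 1" "j \<ge> 1" for i j
  proof -
    from that obtain i' j' where ij: "i = Suc i'" "j = Suc j'" by (metis Suc_le_D One_nat_def)
    have z: "(N\<^sub>1 ^^ n) 0 = 0" "(N\<^sub>2 ^^ n) 0 = 0" for n
      by (induction n) (simp_all add: bounded_clinear_zero[OF B(1)] bounded_clinear_zero[OF B(2)])
    have "(N\<^sub>2 ^^ j) l = 0" using l(1) z(2) by (simp only: ij funpow_Suc_right comp_apply)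
    moreover have "(N\<^sub>1 ^^ i) ((N\<^sub>2 ^^ j) k\<^sub>1) = 0"
      using k1(1) z by (simp only: ij(1) funpow_Suc_right comp_apply comm_pow(1))
    ultimately show ?thesis
      by (simp add: g_def r_def bounded_clinear_funpow_diff[OF B(1)] bounded_clinear_funpow_diff[OF B(2)] z)
  qed
  have perp_pow: "cinner k ((N\<^sub>1 ^^ i) g) = 0" if "N\<^sub>2 k = 0" for i k
    using that
  proof (induction i arbitrary: k)
    case (Suc i)
    show ?case
      by (simp, rule kernel_perp_invariant[OF N(2) B(1)]) (use comm Suc in auto)
  qed (simp add: g2)
  have "norm ((N\<^sub>1 ^^ i) g) = c" if i: "i \<ge> 1" for i
  proof -
    let ?z = "(N\<^sub>1 ^^ i) g"
    have e: "norm ((N\<^sub>2 ^^ j) ?z) = c" if "j \<ge> 1" for j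
    proof -
      have "(N\<^sub>2 ^^ j) ((N\<^sub>1 ^^ i) g) = (N\<^sub>1 ^^ i) ((N\<^sub>2 ^^ j) g)"
        by (induction j) (simp_all add: comm_pow)
      then show ?thesis using powg[OF i that] c[OF i that] by simp
    qed
    have "norm ?z = norm (N\<^sub>2 ?z)"
      by (rule norm_eq_of_perp_kernel[OF N(2)])
         (use perp_pow e[of 1] e[of 2] e[of 3] in \<open>simp_all add: numeral_eq_Suc\<close>)
    then show ?thesis using e[of 1] by simp
  qed
  note e = this
  have "norm g = norm (N\<^sub>1 g)"
    by (rule norm_eq_of_perp_kernel[OF N(1)])
       (use g1 e[of 1] e[of 2] e[of 3] in \<open>simp_all add: numeral_eq_Suc\<close>)
  then have g: "norm g = c" using e[of 1] by simp
  \<comment> \<open>The vector \<open>l\<close> is the projection of \<open>k\<^sub>2\<close> onto the complement of \<open>ker N\<^sub>1\<close>.\<close>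
  have "cinner l (k\<^sub>2 - l) = 0"
  proof -
    have a: "cinner l (f - k\<^sub>2) = 0" "cinner l (r - l) = 0" using k2(2)[OF l(1)] l(2)[OF l(1)] .
    have "cinner l k\<^sub>1 = 0"
    proof -
      have l1: "cinner k l = 0" if k: "N\<^sub>1 k = 0" for k
        using r1[OF k] g1[OF k] by (simp add: g_def cinner_diff_right)
      from l1[OF k1(1)] show ?thesis using cinner_commute[of l k\<^sub>1] by simp
    qed
    then show ?thesis using a by (simp add: r_def cinner_diff_right)
  qed
  then have "(norm k\<^sub>2)\<^sup>2 = (norm l)\<^sup>2 + (norm (k\<^sub>2 - l))\<^sup>2"
    using pythagoras[of l "k\<^sub>2 - l"] by simp
  then have le: "(norm l)\<^sup>2 \<le> (norm k\<^sub>2)\<^sup>2" by simp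
  have "(norm f)\<^sup>2 = (norm k\<^sub>1)\<^sup>2 + (norm r)\<^sup>2"
    using pythagoras[of k\<^sub>1 r] r1[OF k1(1)] by (simp add: r_def)
  also have "(norm r)\<^sup>2 = (norm l)\<^sup>2 + (norm g)\<^sup>2"
    using pythagoras[of l g] g2[OF l(1)] by (simp add: g_def)
  finally have "(norm f)\<^sup>2 \<le> (norm k\<^sub>1)\<^sup>2 + (norm k\<^sub>2)\<^sup>2 + c\<^sup>2" using le g by simp
  then show ?thesis using that k1(1) k1(2)[OF k1(1)] k2(1) k2(2)[OF k2(1)] by blast
qed

section \<open>Moments of probability measures on the unit interval\<close>

lemma discriminant_nonpos:
  fixes A B C :: real
  assumes "\<And>l. 0 \<le> A * l\<^sup>2 - 2 * B * l + C"
  shows "B\<^sup>2 \<le> A * C"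
proof (cases "A = 0")
  case True
  have "B = 0"
  proof (rule ccontr)
    assume "B \<noteq> 0"
    then show False using assms[of "(C + 1) / (2 * B)"] True by (simp add: field_simps)
  qed
  then show ?thesis using True by simp
next
  case False
  have "0 < A"
  proof (rule ccontr)
    assume "\<not> 0 < A"
    then have A: "A < 0" using False by simp
    define l where "l = 1 + \<bar>C / A\<bar>"
    have "\<bar>C / A\<bar> < l" "1 \<le> l" by (auto simp: l_def)
    then have "\<bar>C / A\<bar> < l\<^sup>2" using self_le_power[of l 2] by simp
    then have "C < - A * l\<^sup>2" using A by (simp add: abs_divide field_simps)
    then show False using assms[of l] assms[of "- l"] by simp
  qed
  have "0 \<le> A * (A * (B / A)\<^sup>2 - 2 * B * (B / A) + C)" using assms[of "B / A"] \<open>0 < A\<close> by simp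
  also have "\<dots> = A * C - B\<^sup>2" using False by (simp add: field_simps power2_eq_square)
  finally show ?thesis by simp
qed

text \<open>Mass \<open>m > 0\<close> on \<open>[1 + e, \<infinity>)\<close> would make the \<open>k\<close>-th moment at least \<open>(1 + e)\<^sup>k m\<close>, which
  is unbounded in \<open>k\<close>.\<close>

lemma AE_le_1_of_bounded_moments:
  assumes "finite_measure \<mu>" and sets: "sets \<mu> = sets borel"
    and C: "AE t in \<mu>. t \<in> {0..C}" and mom: "\<And>k. (\<integral>t. t ^ k \<partial>\<mu>) \<le> B"
  shows "AE t in \<mu>. t \<in> {0..1::real}"
proof -
  interpret finite_measure \<mu> by fact
  note [measurable_cong] = sets
  have int: "integrable \<mu> (\<lambda>t. t ^ k)" for k
  proof (rule integrable_const_bound[where B = "C ^ k"])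
    show "AE t in \<mu>. norm (t ^ k) \<le> C ^ k"
      using C by eventually_elim (auto intro!: power_mono simp: power_abs)
  qed simp
  have "measure \<mu> {t. 1 + e \<le> t} = 0" if e: "0 < e" for e
  proof -
    let ?M = "measure \<mu> {t. 1 + e \<le> t}"
    have b: "(1 + e) ^ k * ?M \<le> B" for k
    proof -
      have "(1 + e) ^ k * ?M = (\<integral>t. (1 + e) ^ k * indicator {t. 1 + e \<le> t} t \<partial>\<mu>)"
        by (simp add: sets_eq_imp_space_eq[OF sets])
      also have "\<dots> \<le> (\<integral>t. t ^ k \<partial>\<mu>)"
      proof (rule integral_mono_AE)
        show "AE t in \<mu>. (1 + e) ^ k * indicator {t. 1 + e \<le> t} t \<le> t ^ k"
          using C by eventually_elim (use e in \<open>auto simp: indicator_def intro!: power_mono\<close>)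
      qed (use int in \<open>auto simp: sets sets_eq_imp_space_eq[OF sets] less_top[symmetric]\<close>)
      finally show ?thesis using mom[of k] by linarith
    qed
    show ?thesis
    proof (rule ccontr)
      assume "?M \<noteq> 0"
      then have M: "?M > 0" by (simp add: zero_less_measure_iff)
      obtain k where "B / ?M < (1 + e) ^ k" using real_arch_pow[of "1 + e" "B / ?M"] e by auto
      then show False using b[of k] M by (simp add: field_simps)
    qed
  qed
  then have "AE t in \<mu>. \<not> 1 + e \<le> t" if "0 < e" for e
    using that by (intro AE_I[where N = "{t. 1 + e \<le> t}"]) (auto simp: sets emeasure_eq_measure)
  then have "AE t in \<mu>. \<forall>n. \<not> 1 + 1 / real (Suc n) \<le> t"
    by (subst AE_all_countable) simp
  with C show ?thesis
  proof eventually_elim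
    case (elim t)
    have "t \<le> 1"
    proof (rule ccontr)
      assume "\<not> t \<le> 1"
      then obtain n where "1 / real (Suc n) < t - 1" using nat_approx_posE[of "t - 1"] by auto
      then show False using elim(2)[rule_format, of n] by simp
    qed
    then show ?case using elim(1) by simp
  qed
qed

locale unit_interval_prob = prob_space \<mu> for \<mu> :: "real measure" +
  assumes sets_borel [measurable_cong]: "sets \<mu> = sets borel"
    and unit: "AE t in \<mu>. t \<in> {0..1}"
begin

lemma space_UNIV [simp]: "space \<mu> = UNIV"
  using sets_eq_imp_space_eq[OF sets_borel] by simp

lemma integrable_if_bounded_on_unit:
  fixes f :: "real \<Rightarrow> real"
  assumes [measurable]: "f \<in> borel_measurable borel" and B: "\<And>t. t \<in> {0..1} \<Longrightarrow> \<bar>f t\<bar> \<le> B"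
  shows "integrable \<mu> f"
proof (rule integrable_const_bound[where B = B])
  show "AE t in \<mu>. norm (f t) \<le> B"
    using unit by eventually_elim (simp add: B)
qed simp

lemma integrable_monomial [simp]:
  "integrable \<mu> (\<lambda>t. (1 - t) ^ m * t ^ j)" "integrable \<mu> (\<lambda>t. (1 - t) ^ m)"
  "integrable \<mu> (\<lambda>t. t ^ j)" "integrable \<mu> (\<lambda>t. t)"
  by (rule integrable_if_bounded_on_unit[where B = 1];
      auto simp: power_abs abs_mult intro!: mult_le_one power_le_one)+

lemma power_tendsto_atom: "(\<lambda>n. \<integral>t. t ^ n \<partial>\<mu>) \<longlonglongrightarrow> measure \<mu> {1}"
proof -
  have "(\<lambda>n. \<integral>t. t ^ n \<partial>\<mu>) \<longlonglongrightarrow> (\<integral>t. indicator {1} t \<partial>\<mu>)"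
  proof (rule integral_dominated_convergence[where w = "\<lambda>_. 1"])
    show "AE t in \<mu>. (\<lambda>n. t ^ n) \<longlonglongrightarrow> indicator {1} t"
      using unit
    proof eventually_elim
      case (elim t)
      then show ?case
        by (cases "t = 1") (auto intro!: LIMSEQ_power_zero)
    qed
    show "AE t in \<mu>. norm (t ^ n) \<le> 1" for n
      using unit by eventually_elim (auto simp: power_abs intro!: power_le_one)
  qed auto
  then show ?thesis by simp
qed

lemma compl_power_tendsto_atom: "(\<lambda>n. \<integral>t. (1 - t) ^ n \<partial>\<mu>) \<longlonglongrightarrow> measure \<mu> {0}"
proof -
  have "(\<lambda>n. \<integral>t. (1 - t) ^ n \<partial>\<mu>) \<longlonglongrightarrow> (\<integral>t. indicator {0} t \<partial>\<mu>)"
  proof (rule integral_dominated_convergence[where w = "\<lambda>_. 1"])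
    show "AE t in \<mu>. (\<lambda>n. (1 - t) ^ n) \<longlonglongrightarrow> indicator {0} t"
      using unit
    proof eventually_elim
      case (elim t)
      then show ?case
        by (cases "t = 0") (auto intro!: LIMSEQ_power_zero)
    qed
    show "AE t in \<mu>. norm ((1 - t) ^ n) \<le> 1" for n
      using unit by eventually_elim (auto simp: power_abs intro!: power_le_one)
  qed auto
  then show ?thesis by simp
qed

text \<open>Applied to \<open>t\<^sup>i (t - l)\<^sup>2\<close> with \<open>l\<close> arbitrary, this gives the quadratic inequalities between moments and
  atoms.\<close>

lemma atoms_le_integral:
  fixes f :: "real \<Rightarrow> real"
  assumes "integrable \<mu> f" and f: "\<And>t. t \<in> {0..1} \<Longrightarrow> 0 \<le> f t"
  shows "measure \<mu> {0} * f 0 + measure \<mu> {1} * f 1 \<le> (\<integral>t. f t \<partial>\<mu>)"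
proof -
  have "measure \<mu> {0} * f 0 + measure \<mu> {1} * f 1
      = (\<integral>t. f 0 * indicator {0} t + f 1 * indicator {1} t \<partial>\<mu>)"
    by (subst Bochner_Integration.integral_add) (auto simp: less_top[symmetric])
  also have "\<dots> \<le> (\<integral>t. f t \<partial>\<mu>)"
  proof (rule integral_mono_AE)
    show "AE t in \<mu>. f 0 * indicator {0} t + f 1 * indicator {1} t \<le> f t"
      using unit by eventually_elim (auto simp: indicator_def f)
  qed (use assms in \<open>auto simp: less_top[symmetric]\<close>)
  finally show ?thesis .
qed

lemma integral_shifted_square:
  "(\<integral>t. t ^ i * (t - l)\<^sup>2 \<partial>\<mu>) = (\<integral>t. t ^ (i + 2) \<partial>\<mu>) - 2 * l * (\<integral>t. t ^ (i + 1) \<partial>\<mu>) + l\<^sup>2 * (\<integral>t. t ^ i \<partial>\<mu>)"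
  "integrable \<mu> (\<lambda>t. t ^ i * (t - l)\<^sup>2)"
proof -
  have eq: "t ^ i * (t - l)\<^sup>2 = t ^ (i + 2) - 2 * l * t ^ (i + 1) + l\<^sup>2 * t ^ i" for t
    by (simp add: power2_eq_square algebra_simps)
  have i: "integrable \<mu> (\<lambda>t. c * t ^ i)" for c i using integrable_monomial(3) by simp
  show "integrable \<mu> (\<lambda>t. t ^ i * (t - l)\<^sup>2)"
    unfolding eq by (intro Bochner_Integration.integrable_add Bochner_Integration.integrable_diff i integrable_monomial(3))
  show "(\<integral>t. t ^ i * (t - l)\<^sup>2 \<partial>\<mu>) = (\<integral>t. t ^ (i + 2) \<partial>\<mu>) - 2 * l * (\<integral>t. t ^ (i + 1) \<partial>\<mu>) + l\<^sup>2 * (\<integral>t. t ^ i \<partial>\<mu>)"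
    unfolding eq
    by (subst Bochner_Integration.integral_add Bochner_Integration.integral_diff;
        (intro Bochner_Integration.integrable_add Bochner_Integration.integrable_diff i integrable_monomial(3))?)+ simp
qed

text \<open>A Hankel determinant of the positive measure \<open>\<mu> - c \<delta>\<^sub>1\<close>.  For \<open>i = 0\<close> the mass at \<open>0\<close> may be removed
  as well, which is the second version.\<close>

lemma moment_determinant:
  assumes c: "c \<le> measure \<mu> {1}" and i: "i \<ge> 1"
  shows "((\<integral>t. t ^ (i + 1) \<partial>\<mu>) - c)\<^sup>2 \<le> ((\<integral>t. t ^ i \<partial>\<mu>) - c) * ((\<integral>t. t ^ (i + 2) \<partial>\<mu>) - c)"
proof (rule discriminant_nonpos)
  fix l
  have "c * (1 - l)\<^sup>2 \<le> measure \<mu> {1} * (1 - l)\<^sup>2" using c by (intro mult_right_mono) auto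
  also have "\<dots> \<le> (\<integral>t. t ^ i * (t - l)\<^sup>2 \<partial>\<mu>)"
    using atoms_le_integral[OF integral_shifted_square(2)[of i l]] i by (simp add: power_0_left)
  finally show "0 \<le> ((\<integral>t. t ^ i \<partial>\<mu>) - c) * l\<^sup>2 - 2 * ((\<integral>t. t ^ (i + 1) \<partial>\<mu>) - c) * l + ((\<integral>t. t ^ (i + 2) \<partial>\<mu>) - c)"
    unfolding integral_shifted_square by (simp add: power2_eq_square algebra_simps)
qed

lemma moment_determinant_0:
  assumes c: "c \<le> measure \<mu> {1}"
  shows "((\<integral>t. t \<partial>\<mu>) - c)\<^sup>2 \<le> (1 - measure \<mu> {0} - c) * ((\<integral>t. t ^ 2 \<partial>\<mu>) - c)"
proof (rule discriminant_nonpos)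
  fix l
  have "c * (1 - l)\<^sup>2 \<le> measure \<mu> {1} * (1 - l)\<^sup>2" using c by (intro mult_right_mono) auto
  also have "measure \<mu> {0} * l\<^sup>2 + \<dots> \<le> (\<integral>t. (t - l)\<^sup>2 \<partial>\<mu>)"
    using atoms_le_integral[OF integral_shifted_square(2)[of 0 l]] by simp
  finally show "0 \<le> (1 - measure \<mu> {0} - c) * l\<^sup>2 - 2 * ((\<integral>t. t \<partial>\<mu>) - c) * l + ((\<integral>t. t ^ 2 \<partial>\<mu>) - c)"
    using integral_shifted_square(1)[of 0 l] prob_space by (simp add: power2_eq_square algebra_simps)
qed

text \<open>The hypothesis says \<open>d\<mu>(t) = C t d\<nu>(t)\<close> through moments, as for the Berger measures of a weighted
  shift and of its restriction to the span of \<open>e\<^sub>1, e\<^sub>2, \<dots>\<close>.  Expanding \<open>1/t\<close> into the series \<open>\<Sum>n. (1 - t)\<^sup>n\<close> of polynomials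
  reduces the claim to moments: the partial sums integrate to \<open>C (1 - \<integral>(1 - t)\<^sup>m d\<nu>)\<close>.\<close>

lemma integral_inverse_of_shifted_moments:
  assumes \<nu>: "unit_interval_prob \<nu>" and C: "0 \<le> C"
    and mom: "\<And>k. (\<integral>t. t ^ k \<partial>\<mu>) = C * (\<integral>t. t ^ Suc k \<partial>\<nu>)"
  shows "(\<integral>t. \<bar>1 / t\<bar> \<partial>\<mu>) = C * (1 - measure \<nu> {0})"
proof -
  interpret \<nu>: unit_interval_prob \<nu> by fact
  have mom': "(\<integral>t. (1 - t) ^ n * t ^ k \<partial>\<mu>) = C * (\<integral>t. (1 - t) ^ n * t ^ Suc k \<partial>\<nu>)" for n k
  proof (induction n arbitrary: k)
    case (Suc n)
    have e: "(1 - t) ^ Suc n * t ^ j = (1 - t) ^ n * t ^ j - (1 - t) ^ n * t ^ Suc j" for t :: real and j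
      by (simp add: algebra_simps)
    show ?case unfolding e
      by (simp only: Bochner_Integration.integral_diff integrable_monomial \<nu>.integrable_monomial Suc.IH right_diff_distrib)
  qed (use mom in simp)
  have sum_eq: "(\<Sum>n<m. (1 - t) ^ n) * t = 1 - (1 - t) ^ m" for m and t :: real
    by (induction m) (simp_all add: algebra_simps)
  \<comment> \<open>At \<open>t = 0\<close> the geometric series diverges, while \<open>1 / 0 = 0\<close>; no mass may sit there.\<close>
  have null: "measure \<mu> {0} = 0"
  proof -
    have "(\<lambda>n. \<integral>t. (1 - t) ^ n \<partial>\<mu>) \<longlonglongrightarrow> C * (measure \<nu> {0} - measure \<nu> {0})"
    proof -
      have "(\<integral>t. (1 - t) ^ n \<partial>\<mu>) = C * ((\<integral>t. (1 - t) ^ n \<partial>\<nu>) - (\<integral>t. (1 - t) ^ Suc n \<partial>\<nu>))" for n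
      proof -
        have "(1 - t) ^ n * t = (1 - t) ^ n - (1 - t) ^ Suc n" for t :: real
          by (simp add: algebra_simps)
        then show ?thesis
          using mom'[of n 0]
          by (simp only: power_0 power_Suc0_right mult_1_right One_nat_def[symmetric] power_one_right
              Bochner_Integration.integral_diff \<nu>.integrable_monomial)
      qed
      then show ?thesis
        using tendsto_mult[OF tendsto_const[of C] tendsto_diff[OF \<nu>.compl_power_tendsto_atom
            LIMSEQ_Suc[OF \<nu>.compl_power_tendsto_atom]]] by simp
    qed
    from LIMSEQ_unique[OF compl_power_tendsto_atom this] show ?thesis by simp
  qed
  then have "AE t in \<mu>. t \<noteq> 0"
    by (intro AE_I[where N = "{0}"]) (auto simp: emeasure_eq_measure)
  with unit have pos: "AE t in \<mu>. t \<in> {0<..1}" by eventually_elim auto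
  have "integral\<^sup>L \<mu> (\<lambda>t. \<bar>1 / t\<bar>) = C * (1 - measure \<nu> {0})"
  proof (rule integral_monotone_convergence)
    show "integrable \<mu> (\<lambda>t. \<Sum>n<m. (1 - t) ^ n)" for m by simp
    show "AE t in \<mu>. mono (\<lambda>m. \<Sum>n<m. (1 - t) ^ n)"
      using pos by eventually_elim (auto intro!: monoI sum_mono2)
    show "AE t in \<mu>. (\<lambda>m. \<Sum>n<m. (1 - t) ^ n) \<longlonglongrightarrow> \<bar>1 / t\<bar>"
      using pos
    proof eventually_elim
      case (elim t)
      then have "(\<lambda>n. (1 - t) ^ n) sums (1 / (1 - (1 - t)))" by (intro geometric_sums) auto
      then show ?case using elim by (simp add: sums_def)
    qed
    have "(\<integral>t. (\<Sum>n<m. (1 - t) ^ n) \<partial>\<mu>) = C * (1 - (\<integral>t. (1 - t) ^ m \<partial>\<nu>))" for m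
    proof -
      have "(\<integral>t. (\<Sum>n<m. (1 - t) ^ n) \<partial>\<mu>) = (\<Sum>n<m. C * (\<integral>t. (1 - t) ^ n * t \<partial>\<nu>))"
        using mom'[of _ 0] by (simp add: Bochner_Integration.integral_sum)
      also have "\<dots> = C * (\<integral>t. (\<Sum>n<m. (1 - t) ^ n) * t \<partial>\<nu>)"
        using \<nu>.integrable_monomial(1)[of _ 1]
        by (simp add: sum_distrib_right Bochner_Integration.integral_sum sum_distrib_left)
      also have "\<dots> = C * (1 - (\<integral>t. (1 - t) ^ m \<partial>\<nu>))"
        unfolding sum_eq using \<nu>.prob_space by simp
      finally show ?thesis .
    qed
    then show "(\<lambda>m. \<integral>t. (\<Sum>n<m. (1 - t) ^ n) \<partial>\<mu>) \<longlonglongrightarrow> C * (1 - measure \<nu> {0})"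
      by (simp, intro tendsto_intros \<nu>.compl_power_tendsto_atom)
  qed simp
  then show ?thesis .
qed

end

lemma berger_unit_interval:
  assumes \<mu>: "berger_measure \<omega> \<mu>" and \<omega>: "\<And>k. \<bar>\<omega> k\<bar> \<le> 1"
  shows "unit_interval_prob \<mu>" and "(\<Prod>i<k. (\<omega> i)\<^sup>2) = (\<integral>t. t ^ k \<partial>\<mu>)"
proof -
  from \<mu> have prob: "prob_space \<mu>" and sets: "sets \<mu> = sets borel"
    and mom: "\<And>k. k \<ge> 1 \<Longrightarrow> (\<Prod>i<k. (\<omega> i)\<^sup>2) = (\<integral>t. t ^ k \<partial>\<mu>)"
    by (auto simp: berger_measure_def borel_prob_def)
  interpret prob_space \<mu> by (rule prob)
  show mom': "(\<Prod>i<k. (\<omega> i)\<^sup>2) = (\<integral>t. t ^ k \<partial>\<mu>)" for k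
    by (cases "k = 0") (use mom[of k] prob_space in simp_all)
  from \<mu> obtain C where C: "AE t in \<mu>. t \<in> {0..C}" by (auto simp: berger_measure_def)
  have "AE t in \<mu>. t \<in> {0..1}"
  proof (rule AE_le_1_of_bounded_moments[OF finite_measure_axioms sets C])
    show "(\<integral>t. t ^ k \<partial>\<mu>) \<le> 1" for k
      unfolding mom'[symmetric] using \<omega> by (intro prod_le_1) (auto simp: abs_square_le_1)
  qed
  then show "unit_interval_prob \<mu>"
    using prob sets by (simp add: unit_interval_prob_def unit_interval_prob_axioms_def)
qed

lemma two_atom_mixture_atoms:
  assumes "two_atom_mixture p q \<rho> \<mu>" and \<rho>: "borel_prob \<rho>" "measure \<rho> ({0} \<union> {1}) = 0"
  shows "measure \<mu> {0} = p" "measure \<mu> {1} = q"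
proof -
  interpret prob_space \<rho> using \<rho> by (simp add: borel_prob_def)
  have s: "sets \<rho> = sets borel" using \<rho> by (simp add: borel_prob_def)
  have "measure \<rho> A \<le> measure \<rho> ({0} \<union> {1})" if "A \<subseteq> {0} \<union> {1}" for A
    using that by (intro finite_measure_mono) (auto simp: s)
  then have "measure \<rho> {0} = 0" "measure \<rho> {1} = 0"
    using \<rho>(2) measure_nonneg[of \<rho>] by (metis Un_upper1 Un_upper2 antisym)+
  with assms(1) show "measure \<mu> {0} = p" "measure \<mu> {1} = q"
    by (auto simp: two_atom_mixture_def measure_return)
qed

section \<open>An inequality for measures with two atoms\<close>

text \<open>Here \<open>X\<close> and \<open>G\<close> are the first two moments of a measure with atoms \<open>p\<close> at \<open>0\<close> and \<open>q\<close> at \<open>1\<close>, the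
  hypothesis on \<open>G\<close> being \<open>\<integral>(t - m)\<^sup>2 \<ge> p m\<^sup>2 + q (1 - m)\<^sup>2\<close>.  So \<open>E = \<integral>(t - A)\<^sup>2\<close>, of which \<open>E0\<close> is
  the contribution of the atoms; \<open>V\<close> is the variance; \<open>b\<close> is the contribution of the atoms to \<open>X - A\<close>; and \<open>A + d\<close> is
  the barycentre of the remaining mass \<open>r\<close>.  Since \<open>E \<ge> E0 + r d\<^sup>2\<close> and \<open>E0 - pq = b\<^sup>2 + r E0\<close>, the
  Cauchy-Schwarz defect \<open>r (E0 - b d)\<^sup>2 > 0\<close> yields \<open>pq E < V E0\<close>.  This contradicts
  \<open>W \<le> min (q / A) (p / l)\<close> because \<open>E0 = p A\<^sup>2 + q (1 - A)\<^sup>2\<close> combines the two terms of \<open>W\<close>.\<close>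

lemma min_less_ratio:
  fixes p q A X G Y l :: real
  assumes p: "0 < p" and q: "0 < q" and pq: "p + q < 1" and A: "0 < A" "A < 1" and X: "q \<le> X" "X \<le> 1 - p"
    and G: "\<And>m. p * m\<^sup>2 + q * (1 - m)\<^sup>2 \<le> G - 2 * m * X + m\<^sup>2"
    and l: "0 < l" and Y: "(1 - A)\<^sup>2 \<le> l * (Y - A)"
  shows "min (q / A) (p / l) < Y * (G - X\<^sup>2) / (G - X\<^sup>2 + (A - X)\<^sup>2)"
proof -
  define r b where "r = 1 - p - q" and "b = q * (1 - A) - p * A"
  define d where "d = (X - A - b) / r"
  define E0 E V where "E0 = p * A\<^sup>2 + q * (1 - A)\<^sup>2" and "E = G - X\<^sup>2 + (A - X)\<^sup>2" and "V = G - X\<^sup>2"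
  have r: "0 < r" using pq by (simp add: r_def)
  have rd: "r * d = X - A - b" using r by (simp add: d_def)
  have "r * - A \<le> X - A - b" "X - A - b \<le> r * (1 - A)"
    unfolding r_def b_def using X by (simp_all add: algebra_simps)
  then have "r * - A \<le> r * d" "r * d \<le> r * (1 - A)" unfolding rd .
  then have d: "- A \<le> d" "d \<le> 1 - A" using r by (simp_all only: mult_le_cancel_left_pos)
  have E0: "0 < E0" unfolding E0_def using p q A by (intro add_pos_pos mult_pos_pos) auto
  \<comment> \<open>The hypothesis on \<open>G\<close> is used at the barycentre \<open>A + d\<close>, where it is sharpest.\<close>
  have "E0 + r * d\<^sup>2 \<le> E"
  proof -
    have "E - (E0 + r * d\<^sup>2) = (G - 2 * (A + d) * X + (A + d)\<^sup>2) - (p * (A + d)\<^sup>2 + q * (1 - (A + d))\<^sup>2)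
        + 2 * d * (X - A - b - r * d) "
      unfolding E_def E0_def r_def b_def by (simp add: power2_eq_square algebra_simps)
    then show ?thesis using G[of "A + d"] rd by simp
  qed
  moreover have "0 \<le> r * d\<^sup>2" using r by simp
  ultimately have E: "E0 + r * d\<^sup>2 \<le> E" "0 < E" using E0 by linarith+
  have "E0 - b * d = p * A * (A + d) + q * (1 - A) * (1 - A - d)"
    unfolding E0_def b_def by (simp add: power2_eq_square algebra_simps)
  also have "\<dots> > 0"
  proof (cases "A + d = 0")
    case True
    then show ?thesis using q A by (simp add: mult_pos_pos)
  next
    case False
    then have "0 < A + d" using d by simp
    then have "0 < p * A * (A + d)" using p A by simp
    moreover have "0 \<le> q * (1 - A) * (1 - A - d)" using q A d by simp
    ultimately show ?thesis by simp
  qed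
  finally have "0 < r * (E0 - b * d)\<^sup>2" using r by simp
  also have "\<dots> = (E0 + r * d\<^sup>2) * (b\<^sup>2 + r * E0) - (b + r * d)\<^sup>2 * E0"
    by (simp add: power2_eq_square algebra_simps)
  also have "\<dots> \<le> E * (b\<^sup>2 + r * E0) - (b + r * d)\<^sup>2 * E0"
    using E(1) r E0 by (intro diff_right_mono mult_right_mono) auto
  also have "b\<^sup>2 + r * E0 = E0 - p * q"
    unfolding b_def r_def E0_def by (simp add: power2_eq_square algebra_simps)
  also have "b + r * d = X - A" using rd by simp
  also have "E * (E0 - p * q) - (X - A)\<^sup>2 * E0 = V * E0 - p * q * E"
    unfolding E_def V_def by (simp add: power2_eq_square algebra_simps)
  finally have key: "p * q * E < V * E0" by simp
  have "0 < p * q * E" using p q E by simp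
  then have V: "0 < V" using key E0 by (metis less_trans zero_less_mult_pos2)
  show ?thesis
  proof (rule ccontr)
    assume "\<not> ?thesis"
    then have le: "Y * V / E \<le> q / A" "Y * V / E \<le> p / l" by (simp_all add: V_def E_def)
    define W where "W = (A + (1 - A)\<^sup>2 / l) * (V / E)"
    have "A + (1 - A)\<^sup>2 / l \<le> Y" using Y l by (simp add: field_simps)
    then have "W \<le> Y * (V / E)" unfolding W_def using V E by (intro mult_right_mono) auto
    then have "W \<le> q / A" "W \<le> p / l" using le by simp_all
    then have W: "A * W \<le> q" "l * W \<le> p" using A l by (simp_all add: pos_le_divide_eq mult.commute)
    have W': "W * (l * E) = (A * l + (1 - A)\<^sup>2) * V" using l E by (simp add: W_def field_simps)
    have W0: "0 < W" unfolding W_def using A l V E by (intro mult_pos_pos add_pos_nonneg) auto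
    have "V * E0 * W * l = p * (A * l * A * V) * W + q * ((1 - A)\<^sup>2 * V) * (l * W)"
      by (simp add: E0_def power2_eq_square algebra_simps)
    also have "\<dots> \<le> p * (A * l * V) * q + q * ((1 - A)\<^sup>2 * V) * p"
    proof (rule add_mono)
      have "p * (A * l * V) * (A * W) \<le> p * (A * l * V) * q"
        using W p A l V by (intro mult_left_mono) auto
      then show "p * (A * l * A * V) * W \<le> p * (A * l * V) * q" by (simp add: mult_ac)
      show "q * ((1 - A)\<^sup>2 * V) * (l * W) \<le> q * ((1 - A)\<^sup>2 * V) * p"
        using W q V by (intro mult_left_mono) auto
    qed
    also have "\<dots> = p * q * ((A * l + (1 - A)\<^sup>2) * V)" by (simp add: algebra_simps)
    also have "\<dots> = (p * q * E) * (W * l)" unfolding W'[symmetric] by (simp add: mult_ac)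
    finally have "(V * E0) * (W * l) \<le> (p * q * E) * (W * l)" by (simp add: mult_ac)
    then show False using key W0 l by (simp add: mult_le_cancel_right)
  qed
qed

section \<open>Weighted shifts and the six-point test\<close>

lemma cinner_ket: "cinner f (ket k) = coord f k"
proof -
  have "cinner f (ket k) = (\<Sum>\<^sub>\<infinity>i\<in>{k}. coord f i * cnj (coord (ket k) i))"
    unfolding cinner_ell2_def by (rule infsum_cong_neutral) (auto simp: coord_ket)
  then show ?thesis by (simp add: coord_ket)
qed

lemma norm_ket [simp]: "norm (ket k) = 1"
proof -
  have "complex_of_real ((norm (ket k))\<^sup>2) = 1"
    by (simp add: cinner_norm[symmetric] cinner_ket coord_ket del: of_real_power)
  then have "(norm (ket k))\<^sup>2 = 1" using of_real_eq_1_iff by blast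
  then show ?thesis using norm_ge_zero[of "ket k"] by (auto simp: power2_eq_1_iff)
qed

text \<open>Bessel's inequality for the basis vectors indexed by the range of \<open>g\<close>.\<close>

lemma infsum_coord_le_norm:
  assumes g: "inj g"
  shows "(\<lambda>k. (cmod (coord f (g k)))\<^sup>2) summable_on UNIV"
    and "(\<Sum>\<^sub>\<infinity>k. (cmod (coord f (g k)))\<^sup>2) \<le> (norm f)\<^sup>2"
proof -
  have s: "(\<lambda>i. (cmod (coord f i))\<^sup>2) summable_on range g"
    using coord_summable by (rule summable_on_subset_banach) simp
  then show "(\<lambda>k. (cmod (coord f (g k)))\<^sup>2) summable_on UNIV"
    using summable_on_reindex[OF g, of "\<lambda>i. (cmod (coord f i))\<^sup>2"] by (simp add: comp_def)
  have "(\<Sum>\<^sub>\<infinity>k. (cmod (coord f (g k)))\<^sup>2) = (\<Sum>\<^sub>\<infinity>i\<in>range g. (cmod (coord f i))\<^sup>2)"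
    using infsum_reindex[OF g, of "\<lambda>i. (cmod (coord f i))\<^sup>2"] by (simp add: comp_def)
  also have "\<dots> \<le> (\<Sum>\<^sub>\<infinity>i. (cmod (coord f i))\<^sup>2)"
    by (rule infsum_mono_neutral[OF s coord_summable]) auto
  finally show "(\<Sum>\<^sub>\<infinity>k. (cmod (coord f (g k)))\<^sup>2) \<le> (norm f)\<^sup>2" by (simp add: norm_ell2_sq)
qed

lemma coord_cadj_shift_op:
  assumes "inj s" "bounded (range w)"
  shows "coord (cadj (shift_op s w) f) k = w k * coord f (s k)"
proof -
  have "coord (cadj (shift_op s w) f) k = cnj (cinner (ket k) (cadj (shift_op s w) f))"
    by (metis cinner_ket cinner_commute)
  also have "\<dots> = cnj (cinner (w k *\<^sub>R ket (s k)) f)"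
    by (simp add: cadj_works[OF bounded_clinear_shift_op[OF assms], symmetric] shift_op_ket[OF assms])
  also have "\<dots> = w k * cnj (cinner (ket (s k)) f)"
    by (simp add: scaleR_scaleC cinner_scaleC_left)
  also have "\<dots> = w k * coord f (s k)" by (metis cinner_ket cinner_commute)
  finally show ?thesis .
qed

lemma weight_le_onorm:
  assumes "inj s" "bounded (range w)"
  shows "\<bar>w k\<bar> \<le> onorm (shift_op s w)"
proof -
  have "bounded_linear (shift_op s w)"
    using bounded_clinear_shift_op[OF assms] by (simp add: bounded_clinear_def)
  from onorm[OF this, of "ket k"] show ?thesis by (simp add: shift_op_ket[OF assms])
qed

text \<open>Positivity of the real symmetric matrix with diagonal \<open>A\<close>, \<open>C\<close> and off-diagonal entry \<open>B\<close>, tested on a complex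
  vector.\<close>

lemma cross_term_nonneg:
  fixes A B C :: real and u v :: complex
  assumes "0 \<le> A" "0 \<le> C" "B\<^sup>2 \<le> A * C"
  shows "0 \<le> A * (cmod u)\<^sup>2 + C * (cmod v)\<^sup>2 + 2 * B * Re (u * cnj v)"
proof -
  have "\<bar>B\<bar> \<le> sqrt A * sqrt C"
    using real_sqrt_le_mono[OF assms(3)] by (simp add: real_sqrt_mult)
  moreover have "\<bar>Re (u * cnj v)\<bar> \<le> cmod u * cmod v"
    using abs_Re_le_cmod[of "u * cnj v"] by (simp add: norm_mult)
  ultimately have "\<bar>B\<bar> * \<bar>Re (u * cnj v)\<bar> \<le> (sqrt A * sqrt C) * (cmod u * cmod v)"
    by (intro mult_mono) auto
  then have "- (B * Re (u * cnj v)) \<le> (sqrt A * cmod u) * (sqrt C * cmod v)"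
    using abs_ge_minus_self[of "B * Re (u * cnj v)"] by (simp add: abs_mult mult_ac)
  moreover have "2 * ((sqrt A * cmod u) * (sqrt C * cmod v)) \<le> (sqrt A * cmod u)\<^sup>2 + (sqrt C * cmod v)\<^sup>2"
    using sum_squares_bound[of "sqrt A * cmod u" "sqrt C * cmod v"] by simp
  ultimately show ?thesis using assms by (simp add: power_mult_distrib)
qed

lemma commutator_form:
  fixes T\<^sub>1 T\<^sub>2 :: "'a::chilbert_space \<Rightarrow> 'a"
  assumes T: "bounded_clinear T\<^sub>1" "bounded_clinear T\<^sub>2"
  shows "cinner (commutator (cadj T\<^sub>1) T\<^sub>1 x + commutator (cadj T\<^sub>2) T\<^sub>1 y) x
       + cinner (commutator (cadj T\<^sub>1) T\<^sub>2 x + commutator (cadj T\<^sub>2) T\<^sub>2 y) y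
     = complex_of_real (((norm (T\<^sub>1 x))\<^sup>2 + (norm (T\<^sub>2 y))\<^sup>2 + 2 * Re (cinner (T\<^sub>2 x) (T\<^sub>1 y)))
         - ((norm (cadj T\<^sub>1 x))\<^sup>2 + (norm (cadj T\<^sub>2 y))\<^sup>2 + 2 * Re (cinner (cadj T\<^sub>1 x) (cadj T\<^sub>2 y))))"
proof -
  have re: "complex_of_real (2 * Re (cinner z w)) = cinner z w + cinner w z" for z w :: 'a
    by (subst (3) cinner_commute) (simp only: complex_add_cnj)
  have "cinner (T\<^sub>1 (cadj S z)) w = cinner (cadj S z) (cadj T\<^sub>1 w)"
    "cinner (T\<^sub>2 (cadj S z)) w = cinner (cadj S z) (cadj T\<^sub>2 w)" for S :: "'a \<Rightarrow> 'a" and z w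
    by (rule cadj_works[OF T(1)], rule cadj_works[OF T(2)])
  then show ?thesis
    unfolding of_real_add of_real_diff re
    by (simp add: commutator_def cinner_add_left cinner_diff_left cadj_works'[OF T(1)] cadj_works'[OF T(2)]
        cinner_norm[symmetric] del: of_real_power)
qed

abbreviation "right_step \<equiv> \<lambda>(i, j). (Suc i, j :: nat)"
abbreviation "up_step \<equiv> \<lambda>(i :: nat, j). (i, Suc j)"

lemma inj_steps: "inj right_step" "inj up_step"
  by (auto simp: inj_on_def)

locale weighted_shift_pair =
  fixes \<alpha> \<beta> :: "nat \<times> nat \<Rightarrow> real"
  assumes comm: "commuting_weights \<alpha> \<beta>"
begin

lemma bounded_weights: "bounded (range \<alpha>)" "bounded (range \<beta>)"
  and weights_pos: "0 < \<alpha> k" "0 < \<beta> k"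
  and weights_commute: "\<beta> (Suc i, j) * \<alpha> (i, j) = \<alpha> (i, Suc j) * \<beta> (i, j)"
  using comm unfolding commuting_weights_def by blast+

lemma bounded_clinear_T: "bounded_clinear (T1_of \<alpha>)" "bounded_clinear (T2_of \<beta>)"
  unfolding T1_of_def T2_of_def by (intro bounded_clinear_shift_op inj_steps bounded_weights)+

lemma T_ket: "T1_of \<alpha> (ket (i, j)) = \<alpha> (i, j) *\<^sub>R ket (Suc i, j)"
  "T2_of \<beta> (ket (i, j)) = \<beta> (i, j) *\<^sub>R ket (i, Suc j)"
  unfolding T1_of_def T2_of_def
  by (simp_all add: shift_op_ket[OF inj_steps(1) bounded_weights(1)] shift_op_ket[OF inj_steps(2) bounded_weights(2)])

lemma coord_T:
  "coord (T1_of \<alpha> f) (Suc i, j) = \<alpha> (i, j) * coord f (i, j)" "coord (T1_of \<alpha> f) (0, j) = 0"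
  "coord (T2_of \<beta> f) (i, Suc j) = \<beta> (i, j) * coord f (i, j)" "coord (T2_of \<beta> f) (i, 0) = 0"
proof -
  have "(Suc i, j) = right_step (i, j)" "(i, Suc j) = up_step (i, j)" by simp_all
  then have "inv right_step (Suc i, j) = (i, j)" "inv up_step (i, Suc j) = (i, j)"
    by (metis inv_f_f inj_steps(1)) (metis inv_f_f inj_steps(2) \<open>(i, Suc j) = up_step (i, j)\<close>)
  moreover have "(Suc i, j) \<in> range right_step" "(i, Suc j) \<in> range up_step"
    "(0, j) \<notin> range right_step" "(i, 0) \<notin> range up_step"
    by (auto simp: image_iff)
  ultimately show "coord (T1_of \<alpha> f) (Suc i, j) = \<alpha> (i, j) * coord f (i, j)" "coord (T1_of \<alpha> f) (0, j) = 0"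
  "coord (T2_of \<beta> f) (i, Suc j) = \<beta> (i, j) * coord f (i, j)" "coord (T2_of \<beta> f) (i, 0) = 0"
    unfolding T1_of_def T2_of_def
    by (simp_all add: coord_shift_op[OF inj_steps(1) bounded_weights(1)] coord_shift_op[OF inj_steps(2) bounded_weights(2)]
        del: split_paired_Ex)
qed

lemma coord_cadj_T:
  "coord (cadj (T1_of \<alpha>) f) (i, j) = \<alpha> (i, j) * coord f (Suc i, j)"
  "coord (cadj (T2_of \<beta>) f) (i, j) = \<beta> (i, j) * coord f (i, Suc j)"
  unfolding T1_of_def T2_of_def
  by (simp_all add: coord_cadj_shift_op[OF inj_steps(1) bounded_weights(1)] coord_cadj_shift_op[OF inj_steps(2) bounded_weights(2)])

lemma T_commute: "T1_of \<alpha> \<circ> T2_of \<beta> = T2_of \<beta> \<circ> T1_of \<alpha>"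
proof (rule ext, rule ell2_eqI)
  fix f and k :: "nat \<times> nat"
  obtain i j where k: "k = (i, j)" by (cases k)
  have "complex_of_real (\<beta> (i, j)) * complex_of_real (\<alpha> (i, Suc j)) = complex_of_real (\<alpha> (i, j)) * complex_of_real (\<beta> (Suc i, j))" for i j
    using weights_commute[of i j] by (simp only: of_real_mult[symmetric] mult.commute)
  then show "coord ((T1_of \<alpha> \<circ> T2_of \<beta>) f) k = coord ((T2_of \<beta> \<circ> T1_of \<alpha>) f) k"
    unfolding k by (cases i; cases j) (simp_all add: coord_T flip: mult.assoc, simp add: mult.commute)
qed

lemma cinner_T2_T1:
  "((\<lambda>(i, j). (\<beta> (Suc i, j) * \<alpha> (i, Suc j)) * Re (coord x (Suc i, j) * cnj (coord y (i, Suc j))))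
     has_sum Re (cinner (T2_of \<beta> x) (T1_of \<alpha> y))) UNIV"
proof -
  let ?p = "\<lambda>(i, j). (Suc i, Suc j)"
  let ?F = "\<lambda>k. coord (T2_of \<beta> x) k * cnj (coord (T1_of \<alpha> y) k)"
  have "(?F has_sum cinner (T2_of \<beta> x) (T1_of \<alpha> y)) UNIV"
    unfolding cinner_ell2_def by (rule has_sum_infsum[OF ell2_prod_summable])
  moreover have "?F k = 0" if "k \<notin> range ?p" for k
  proof -
    obtain i j where k: "k = (i, j)" by (cases k)
    have "i = 0 \<or> j = 0" using that unfolding k by (cases i; cases j) (auto simp: image_iff)
    then show ?thesis unfolding k by (auto simp: coord_T)
  qed
  ultimately have "(?F has_sum cinner (T2_of \<beta> x) (T1_of \<alpha> y)) (range ?p)"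
    by (subst has_sum_cong_neutral[where T = UNIV and g = ?F]) auto
  moreover have "inj ?p" by (auto simp: inj_on_def)
  ultimately have "(?F \<circ> ?p has_sum cinner (T2_of \<beta> x) (T1_of \<alpha> y)) UNIV"
    by (simp add: has_sum_reindex)
  from has_sum_Re[OF this] show ?thesis
    by (rule has_sum_cong[THEN iffD1, rotated]) (auto simp: coord_T algebra_simps)
qed

text \<open>Collecting the coordinates of \<open>x\<close> at \<open>k + (1,0)\<close> and of \<open>y\<close> at \<open>k + (0,1)\<close>, the quadratic form of
  \<open>commutator_form\<close> becomes a sum over \<open>k\<close> of \<open>2 \<times> 2\<close> forms, whose positivity is the assumption, plus the
  contributions to \<open>\<parallel>T\<^sub>1 x\<parallel>\<^sup>2\<close> and \<open>\<parallel>T\<^sub>2 y\<parallel>\<^sup>2\<close> of coordinates of \<open>x\<close> and \<open>y\<close> on the coordinate axes, which are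
  nonnegative.\<close>

lemma six_point_test:
  assumes mono: "\<And>i j. (\<alpha> (i, j))\<^sup>2 \<le> (\<alpha> (Suc i, j))\<^sup>2" "\<And>i j. (\<beta> (i, j))\<^sup>2 \<le> (\<beta> (i, Suc j))\<^sup>2"
    and det: "\<And>i j. (\<beta> (Suc i, j) * \<alpha> (i, Suc j) - \<alpha> (i, j) * \<beta> (i, j))\<^sup>2
      \<le> ((\<alpha> (Suc i, j))\<^sup>2 - (\<alpha> (i, j))\<^sup>2) * ((\<beta> (i, Suc j))\<^sup>2 - (\<beta> (i, j))\<^sup>2)"
  shows "hyponormal_pair (T1_of \<alpha>) (T2_of \<beta>)"
  unfolding hyponormal_pair_def
proof (intro conjI allI T_commute)
  fix x y
  let ?T1 = "T1_of \<alpha>" and ?T2 = "T2_of \<beta>"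
  let ?c = "\<lambda>k. Re (coord x (right_step k) * cnj (coord y (up_step k)))"
  \<comment> \<open>\<open>?P\<close> and \<open>?Q\<close> are the terms at \<open>k\<close> of the positive part of the form, without the coordinates on the
    axes, and of its negative part.\<close>
  let ?P = "\<lambda>k. (cmod (coord (?T1 x) (right_step (right_step k))))\<^sup>2
     + (cmod (coord (?T2 y) (up_step (up_step k))))\<^sup>2 + 2 * (\<beta> (right_step k) * \<alpha> (up_step k) * ?c k)"
  let ?Q = "\<lambda>k. (cmod (coord (cadj ?T1 x) k))\<^sup>2 + (cmod (coord (cadj ?T2 y) k))\<^sup>2
     + 2 * Re (coord (cadj ?T1 x) k * cnj (coord (cadj ?T2 y) k))"
  have inj2: "inj (\<lambda>k. right_step (right_step k))" "inj (\<lambda>k. up_step (up_step k))"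
    by (auto simp: inj_on_def)
  have cross: "((\<lambda>k. \<beta> (right_step k) * \<alpha> (up_step k) * ?c k) has_sum Re (cinner (?T2 x) (?T1 y))) UNIV"
    using cinner_T2_T1[of x y] by (simp add: case_prod_unfold)
  have P: "(?P has_sum ((\<Sum>\<^sub>\<infinity>k. (cmod (coord (?T1 x) (right_step (right_step k))))\<^sup>2)
     + (\<Sum>\<^sub>\<infinity>k. (cmod (coord (?T2 y) (up_step (up_step k))))\<^sup>2) + 2 * Re (cinner (?T2 x) (?T1 y)))) UNIV"
    by (intro has_sum_add has_sum_infsum infsum_coord_le_norm(1) inj2 has_sum_cmult_right cross)
  have "((\<lambda>k. Re (coord (cadj ?T1 x) k * cnj (coord (cadj ?T2 y) k))) has_sum Re (cinner (cadj ?T1 x) (cadj ?T2 y))) UNIV"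
    unfolding cinner_ell2_def by (intro has_sum_Re has_sum_infsum ell2_prod_summable)
  then have Q: "(?Q has_sum ((norm (cadj ?T1 x))\<^sup>2 + (norm (cadj ?T2 y))\<^sup>2
     + 2 * Re (cinner (cadj ?T1 x) (cadj ?T2 y)))) UNIV"
    unfolding norm_ell2_sq by (intro has_sum_add has_sum_infsum coord_summable has_sum_cmult_right)
  have "?Q k \<le> ?P k" for k
  proof -
    obtain i j where k: "k = (i, j)" by (cases k)
    have sq: "(cmod (complex_of_real r * z))\<^sup>2 = r\<^sup>2 * (cmod z)\<^sup>2" for r z
      by (simp add: norm_mult power_mult_distrib)
    have "0 \<le> ((\<alpha> (Suc i, j))\<^sup>2 - (\<alpha> (i, j))\<^sup>2) * (cmod (coord x (Suc i, j)))\<^sup>2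
        + ((\<beta> (i, Suc j))\<^sup>2 - (\<beta> (i, j))\<^sup>2) * (cmod (coord y (i, Suc j)))\<^sup>2
        + 2 * (\<beta> (Suc i, j) * \<alpha> (i, Suc j) - \<alpha> (i, j) * \<beta> (i, j)) * Re (coord x (Suc i, j) * cnj (coord y (i, Suc j)))"
      by (rule cross_term_nonneg) (use mono det in auto)
    then show ?thesis
      unfolding k by (simp add: coord_T coord_cadj_T sq) (simp add: algebra_simps)
  qed
  then have "(norm (cadj ?T1 x))\<^sup>2 + (norm (cadj ?T2 y))\<^sup>2 + 2 * Re (cinner (cadj ?T1 x) (cadj ?T2 y))
    \<le> (\<Sum>\<^sub>\<infinity>k. (cmod (coord (?T1 x) (right_step (right_step k))))\<^sup>2)
     + (\<Sum>\<^sub>\<infinity>k. (cmod (coord (?T2 y) (up_step (up_step k))))\<^sup>2) + 2 * Re (cinner (?T2 x) (?T1 y))"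
    by (rule has_sum_mono[OF Q P])
  also have "\<dots> \<le> (norm (?T1 x))\<^sup>2 + (norm (?T2 y))\<^sup>2 + 2 * Re (cinner (?T2 x) (?T1 y))"
    by (intro add_mono infsum_coord_le_norm(2) inj2 order_refl)
  finally show "cinner (commutator (cadj ?T1) ?T1 x + commutator (cadj ?T2) ?T1 y) x
       + cinner (commutator (cadj ?T1) ?T2 x + commutator (cadj ?T2) ?T2 y) y \<in> \<real>\<^sub>\<ge>\<^sub>0"
    unfolding commutator_form[OF bounded_clinear_T] nonneg_Reals_of_real_iff by simp
qed

end

section \<open>Flat contractive pairs\<close>

text \<open>The entry \<open>b\<close> is a weight leaving the edge at the vertex \<open>i\<close>, and \<open>b'\<close> is the next one.  With
  \<open>P = \<integral>t\<^sup>i d\<mu>\<close>, the number \<open>b\<^sup>2 P\<close> is the mass removed at \<open>1\<close> in \<open>moment_determinant\<close>, and the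
  second claim is that inequality divided by \<open>P\<^sup>2 w\<^sub>i\<^sup>2\<close> and rearranged.  The first claim is the case where
  no mass is removed.\<close>

lemma edge_six_point:
  fixes w :: "nat \<Rightarrow> real"
  assumes \<mu>: "unit_interval_prob \<mu>" and mom: "\<And>k. (\<Prod>l<k. (w l)\<^sup>2) = (\<integral>t. t ^ k \<partial>\<mu>)"
    and w: "\<And>k. 0 < w k"
  shows "(w i)\<^sup>2 \<le> (w (Suc i))\<^sup>2"
    and "i \<ge> 1 \<Longrightarrow> b\<^sup>2 * (\<Prod>l<i. (w l)\<^sup>2) \<le> measure \<mu> {1} \<Longrightarrow> b' * w i = b \<Longrightarrow>
      (b' - w i * b)\<^sup>2 \<le> ((w (Suc i))\<^sup>2 - (w i)\<^sup>2) * (1 - b\<^sup>2)"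
proof -
  interpret unit_interval_prob \<mu> by (rule \<mu>)
  define P where "P = (\<Prod>l<i. (w l)\<^sup>2)"
  have P: "0 < P" unfolding P_def using w by (intro prod_pos) (simp add: less_imp_neq[THEN not_sym])
  have m: "(\<integral>t. t ^ i \<partial>\<mu>) = P" "(\<integral>t. t ^ (i + 1) \<partial>\<mu>) = P * (w i)\<^sup>2"
    "(\<integral>t. t ^ (i + 2) \<partial>\<mu>) = P * (w i)\<^sup>2 * (w (Suc i))\<^sup>2"
    unfolding mom[symmetric] P_def by simp_all
  have wi: "0 < (w i)\<^sup>2" using w[of i] by simp
  have "(P * (w i)\<^sup>2)\<^sup>2 \<le> P * (P * (w i)\<^sup>2 * (w (Suc i))\<^sup>2)"
  proof (cases "i = 0")
    case True
    have "(\<integral>t. t \<partial>\<mu>)\<^sup>2 \<le> (1 - measure \<mu> {0}) * (\<integral>t. t ^ 2 \<partial>\<mu>)"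
      using moment_determinant_0[of 0] by simp
    also have "\<dots> \<le> 1 * (\<integral>t. t ^ 2 \<partial>\<mu>)"
      by (intro mult_right_mono) auto
    finally show ?thesis using m True by (simp add: P_def numeral_2_eq_2)
  next
    case False
    then show ?thesis using moment_determinant[of 0 i] m by simp
  qed
  then have "(P\<^sup>2 * (w i)\<^sup>2) * (w i)\<^sup>2 \<le> (P\<^sup>2 * (w i)\<^sup>2) * (w (Suc i))\<^sup>2"
    by (simp add: power2_eq_square mult_ac)
  then show "(w i)\<^sup>2 \<le> (w (Suc i))\<^sup>2" using P wi by (simp add: mult_le_cancel_left)
  assume i: "i \<ge> 1" and c: "b\<^sup>2 * (\<Prod>l<i. (w l)\<^sup>2) \<le> measure \<mu> {1}" and b': "b' * w i = b"
  have "(P * (w i)\<^sup>2 - b\<^sup>2 * P)\<^sup>2 \<le> (P - b\<^sup>2 * P) * (P * (w i)\<^sup>2 * (w (Suc i))\<^sup>2 - b\<^sup>2 * P)"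
    using moment_determinant[OF c i] unfolding m P_def[symmetric] .
  then have "P\<^sup>2 * ((w i)\<^sup>2 - b\<^sup>2)\<^sup>2 \<le> P\<^sup>2 * ((1 - b\<^sup>2) * ((w i)\<^sup>2 * (w (Suc i))\<^sup>2 - b\<^sup>2))"
    by (simp add: power2_eq_square algebra_simps)
  then have "((w i)\<^sup>2 - b\<^sup>2)\<^sup>2 \<le> (1 - b\<^sup>2) * ((w i)\<^sup>2 * (w (Suc i))\<^sup>2 - b\<^sup>2)"
    using P by (simp add: mult_le_cancel_left)
  moreover have "(w i)\<^sup>2 * (b' - w i * b)\<^sup>2 = (b - (w i)\<^sup>2 * b)\<^sup>2"
    unfolding b'[symmetric] by (simp add: power2_eq_square algebra_simps)
  ultimately have "(w i)\<^sup>2 * (b' - w i * b)\<^sup>2 \<le> (w i)\<^sup>2 * (((w (Suc i))\<^sup>2 - (w i)\<^sup>2) * (1 - b\<^sup>2))"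
    by (simp add: power2_eq_square algebra_simps)
  then show "(b' - w i * b)\<^sup>2 \<le> ((w (Suc i))\<^sup>2 - (w i)\<^sup>2) * (1 - b\<^sup>2)"
    using wi by (simp add: mult_le_cancel_left)
qed

locale flat_contractive_pair = weighted_shift_pair +
  assumes flat: "\<And>i j. i \<ge> 1 \<Longrightarrow> j \<ge> 1 \<Longrightarrow> \<alpha> (i, j) = 1 \<and> \<beta> (i, j) = 1"
    and le_1: "\<And>k. \<alpha> k \<le> 1" "\<And>k. \<beta> k \<le> 1"
begin

text \<open>The common length of \<open>T\<^sub>1\<^sup>i T\<^sub>2\<^sup>j e\<^bsub>(0,0)\<^esub>\<close> for \<open>i, j \<ge> 1\<close>.\<close>

definition c :: real where "c = \<alpha> (0, 1) * \<beta> (0, 0)"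

lemma c_pos: "0 < c"
  using weights_pos by (simp add: c_def)

lemma edge_weights:
  "i \<ge> 1 \<Longrightarrow> \<beta> (i, 0) * (\<Prod>l<i. \<alpha> (l, 0)) = c"
  "j \<ge> 1 \<Longrightarrow> \<alpha> (0, j) * (\<Prod>l<j. \<beta> (0, l)) = c"
proof -
  show "\<beta> (i, 0) * (\<Prod>l<i. \<alpha> (l, 0)) = c" if "i \<ge> 1"
    using that
  proof (induction i rule: dec_induct)
    case base
    show ?case using weights_commute[of 0 0] by (simp add: c_def)
  next
    case (step n)
    then have "\<beta> (Suc n, 0) * \<alpha> (n, 0) = \<beta> (n, 0)" using weights_commute[of n 0] flat[of n 1] by simp
    then show ?case using step.IH by (simp add: ac_simps) (metis mult.assoc mult.commute)
  qed
  show "\<alpha> (0, j) * (\<Prod>l<j. \<beta> (0, l)) = c" if "j \<ge> 1"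
    using that
  proof (induction j rule: dec_induct)
    case base
    show ?case by (simp add: c_def)
  next
    case (step n)
    then have "\<alpha> (0, Suc n) * \<beta> (0, n) = \<alpha> (0, n)" using weights_commute[of 0 n] flat[of 1 n] by simp
    then show ?case using step.IH by (simp add: ac_simps) (metis mult.assoc mult.commute)
  qed
qed

lemma edge_weights_sq:
  "i \<ge> 1 \<Longrightarrow> (\<beta> (i, 0))\<^sup>2 * (\<Prod>l<i. (\<alpha> (l, 0))\<^sup>2) = c\<^sup>2"
  "j \<ge> 1 \<Longrightarrow> (\<alpha> (0, j))\<^sup>2 * (\<Prod>l<j. (\<beta> (0, l))\<^sup>2) = c\<^sup>2"
  using edge_weights by (simp_all flip: power_mult_distrib add: prod_power_distrib[symmetric])

text \<open>By contractivity the edge weights satisfy \<open>\<beta>\<^bsub>(i,0)\<^esub> \<le> 1\<close> and \<open>\<alpha>\<^bsub>(0,i)\<^esub> \<le> 1\<close>, so \<open>c\<^sup>2\<close> is below all moments of order \<open>i \<ge> 1\<close>,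
  and these tend to the atom at \<open>1\<close>.\<close>

lemma c_le_atom:
  assumes "berger_measure (\<lambda>i. \<alpha> (i, 0)) \<xi>" "berger_measure (\<lambda>j. \<beta> (0, j)) \<eta>"
  shows "c\<^sup>2 \<le> measure \<xi> {1}" "c\<^sup>2 \<le> measure \<eta> {1}"
proof -
  have a: "\<bar>\<alpha> k\<bar> \<le> 1" "\<bar>\<beta> k\<bar> \<le> 1" for k using weights_pos[of k] le_1[of k] by auto
  interpret \<xi>: unit_interval_prob \<xi> by (rule berger_unit_interval(1)[OF assms(1) a(1)])
  interpret \<eta>: unit_interval_prob \<eta> by (rule berger_unit_interval(1)[OF assms(2) a(2)])
  have le: "b\<^sup>2 * P \<le> P" if "\<bar>b\<bar> \<le> 1" "0 \<le> P" for b P :: real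
    using that by (intro mult_left_le_one_le) (simp_all add: abs_square_le_1)
  have "c\<^sup>2 \<le> (\<Prod>l<i. (\<alpha> (l, 0))\<^sup>2)" "c\<^sup>2 \<le> (\<Prod>l<i. (\<beta> (0, l))\<^sup>2)" if "i \<ge> 1" for i
    using le[OF a(2)[of "(i, 0)"], of "\<Prod>l<i. (\<alpha> (l, 0))\<^sup>2"] le[OF a(1)[of "(0, i)"], of "\<Prod>l<i. (\<beta> (0, l))\<^sup>2"]
    by (simp_all add: edge_weights_sq[OF that] prod_nonneg)
  then have *: "c\<^sup>2 \<le> (\<integral>t. t ^ i \<partial>\<xi>)" "c\<^sup>2 \<le> (\<integral>t. t ^ i \<partial>\<eta>)" if "i \<ge> 1" for i
    using that berger_unit_interval(2)[OF assms(1) a(1)] berger_unit_interval(2)[OF assms(2) a(2)] by simp_all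
  show "c\<^sup>2 \<le> measure \<xi> {1}" using LIMSEQ_le_const[OF \<xi>.power_tendsto_atom] *(1) by blast
  show "c\<^sup>2 \<le> measure \<eta> {1}" using LIMSEQ_le_const[OF \<eta>.power_tendsto_atom] *(2) by blast
qed

text \<open>Only the origin can obstruct hyponormality: in the flat region both sides of the determinant condition vanish, and on the
  edges \<open>c_le_atom\<close> supplies it.\<close>

lemma hyponormal_if_corner:
  assumes \<xi>: "berger_measure (\<lambda>i. \<alpha> (i, 0)) \<xi>" and \<eta>: "berger_measure (\<lambda>j. \<beta> (0, j)) \<eta>"
    and corner: "(\<beta> (1, 0) * \<alpha> (0, 1) - \<alpha> (0, 0) * \<beta> (0, 0))\<^sup>2
      \<le> ((\<alpha> (1, 0))\<^sup>2 - (\<alpha> (0, 0))\<^sup>2) * ((\<beta> (0, 1))\<^sup>2 - (\<beta> (0, 0))\<^sup>2)"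
  shows "hyponormal_pair (T1_of \<alpha>) (T2_of \<beta>)"
proof (rule six_point_test)
  have a: "\<bar>\<alpha> k\<bar> \<le> 1" "\<bar>\<beta> k\<bar> \<le> 1" for k using weights_pos[of k] le_1[of k] by auto
  note U = berger_unit_interval(1)[OF \<xi> a(1)] berger_unit_interval(1)[OF \<eta> a(2)]
  note M = berger_unit_interval(2)[OF \<xi> a(1)] berger_unit_interval(2)[OF \<eta> a(2)]
  note edge = edge_six_point[OF U(1) M(1) weights_pos(1)] edge_six_point[OF U(2) M(2) weights_pos(2)]
  show "(\<alpha> (i, j))\<^sup>2 \<le> (\<alpha> (Suc i, j))\<^sup>2" for i j
    using edge(1)[of i] flat[of "Suc i" j] a(1)[of "(i, j)"] by (cases j) (auto simp: abs_square_le_1)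
  show "(\<beta> (i, j))\<^sup>2 \<le> (\<beta> (i, Suc j))\<^sup>2" for i j
    using edge(3)[of j] flat[of i "Suc j"] a(2)[of "(i, j)"] by (cases i) (auto simp: abs_square_le_1)
  fix i j :: nat
  consider "i = 0" "j = 0" | "i \<ge> 1" "j = 0" | "i = 0" "j \<ge> 1" | "i \<ge> 1" "j \<ge> 1" by fastforce
  then show "(\<beta> (Suc i, j) * \<alpha> (i, Suc j) - \<alpha> (i, j) * \<beta> (i, j))\<^sup>2
      \<le> ((\<alpha> (Suc i, j))\<^sup>2 - (\<alpha> (i, j))\<^sup>2) * ((\<beta> (i, Suc j))\<^sup>2 - (\<beta> (i, j))\<^sup>2)"
  proof cases
    case 1
    then show ?thesis using corner by simp
  next
    case 2
    then have "(\<beta> (Suc i, 0) - \<alpha> (i, 0) * \<beta> (i, 0))\<^sup>2 \<le> ((\<alpha> (Suc i, 0))\<^sup>2 - (\<alpha> (i, 0))\<^sup>2) * (1 - (\<beta> (i, 0))\<^sup>2)"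
      using weights_commute[of i 0] flat[of i 1] c_le_atom(1)[OF \<xi> \<eta>] edge_weights_sq(1)[of i]
      by (intro edge(2)) simp_all
    then show ?thesis using 2 flat[of i 1] by simp
  next
    case 3
    then have "(\<alpha> (0, Suc j) - \<beta> (0, j) * \<alpha> (0, j))\<^sup>2 \<le> ((\<beta> (0, Suc j))\<^sup>2 - (\<beta> (0, j))\<^sup>2) * (1 - (\<alpha> (0, j))\<^sup>2)"
      using weights_commute[of 0 j] flat[of 1 j] c_le_atom(2)[OF \<xi> \<eta>] edge_weights_sq(2)[of j]
      by (intro edge(4)) simp_all
    then show ?thesis using 3 flat[of 1 j] by (simp add: mult.commute)
  next
    case 4
    then show ?thesis using flat[of i j] flat[of "Suc i" j] flat[of i "Suc j"] by simp
  qed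
qed

lemma T_pow_ket:
  "(T1_of \<alpha> ^^ i) (ket (0, 0)) = (\<Prod>l<i. \<alpha> (l, 0)) *\<^sub>R ket (i, 0)"
  "(T2_of \<beta> ^^ j) (ket (0, 0)) = (\<Prod>l<j. \<beta> (0, l)) *\<^sub>R ket (0, j)"
  by (induction i, simp_all add: bounded_clinear_scaleR[OF bounded_clinear_T(1)] T_ket)
     (induction j, simp_all add: bounded_clinear_scaleR[OF bounded_clinear_T(2)] T_ket)

lemma norm_T1_T2_pow_ket:
  assumes "i \<ge> 1" "j \<ge> 1"
  shows "norm ((T1_of \<alpha> ^^ i) ((T2_of \<beta> ^^ j) (ket (0, 0)))) = c"
proof -
  have "(T1_of \<alpha> ^^ i) ((T2_of \<beta> ^^ j) (ket (0, 0))) = c *\<^sub>R ket (i, j)"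
    using assms(1)
  proof (induction i rule: dec_induct)
    case base
    show ?case
      using edge_weights(2)[OF assms(2)]
      by (simp add: T_pow_ket bounded_clinear_scaleR[OF bounded_clinear_T(1)] T_ket mult.commute)
  next
    case (step n)
    then show ?case
      using flat[of n j] assms(2) by (simp add: bounded_clinear_scaleR[OF bounded_clinear_T(1)] T_ket)
  qed
  then show ?thesis using c_pos by simp
qed

text \<open>The two kernel projections of the image of \<open>e\<^bsub>(0,0)\<^esub>\<close> have squared lengths at most the atoms at \<open>0\<close>, and
  everything else has squared length \<open>c\<^sup>2\<close>.\<close>

lemma subnormal_imp_mass_bound:
  assumes \<xi>: "berger_measure (\<lambda>i. \<alpha> (i, 0)) \<xi>" and \<eta>: "berger_measure (\<lambda>j. \<beta> (0, j)) \<eta>"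
    and sub: "subnormal_pair TYPE('k::chilbert_space) (T1_of \<alpha>) (T2_of \<beta>)"
  shows "1 \<le> measure \<xi> {0} + measure \<eta> {0} + c\<^sup>2"
proof -
  have a: "\<bar>\<alpha> k\<bar> \<le> 1" "\<bar>\<beta> k\<bar> \<le> 1" for k using weights_pos[of k] le_1[of k] by auto
  interpret \<xi>: unit_interval_prob \<xi> by (rule berger_unit_interval(1)[OF \<xi> a(1)])
  interpret \<eta>: unit_interval_prob \<eta> by (rule berger_unit_interval(1)[OF \<eta> a(2)])
  obtain V :: "(nat \<times> nat) ell2 \<Rightarrow> 'k" and N\<^sub>1 N\<^sub>2 where V: "\<And>z. norm (V z) = norm z"
    and N: "normal_op N\<^sub>1" "normal_op N\<^sub>2" "\<And>z. N\<^sub>1 (N\<^sub>2 z) = N\<^sub>2 (N\<^sub>1 z)"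
    and ext: "\<And>z. N\<^sub>1 (V z) = V (T1_of \<alpha> z)" "\<And>z. N\<^sub>2 (V z) = V (T2_of \<beta> z)"
    using sub unfolding subnormal_pair_def isometric_embedding_def by (metis comp_apply)
  define f where "f = V (ket (0, 0))"
  have pow: "(N\<^sub>1 ^^ i) (V z) = V ((T1_of \<alpha> ^^ i) z)" "(N\<^sub>2 ^^ i) (V z) = V ((T2_of \<beta> ^^ i) z)" for i z
    by (induction i) (simp_all add: ext)
  have mom: "(norm ((N\<^sub>1 ^^ i) f))\<^sup>2 = (\<integral>t. t ^ i \<partial>\<xi>)" "(norm ((N\<^sub>2 ^^ i) f))\<^sup>2 = (\<integral>t. t ^ i \<partial>\<eta>)" for i
    using berger_unit_interval(2)[OF \<xi> a(1), of i] berger_unit_interval(2)[OF \<eta> a(2), of i]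
    by (simp_all add: f_def pow V T_pow_ket prod_power_distrib)
  have "norm ((N\<^sub>1 ^^ i) ((N\<^sub>2 ^^ j) f)) = c" if "i \<ge> 1" "j \<ge> 1" for i j
    using norm_T1_T2_pow_ket[OF that] by (simp add: f_def pow V)
  from commuting_normal_kernel_bound[OF N this] obtain k\<^sub>1 k\<^sub>2
    where k: "N\<^sub>1 k\<^sub>1 = 0" "cinner k\<^sub>1 (f - k\<^sub>1) = 0" "N\<^sub>2 k\<^sub>2 = 0" "cinner k\<^sub>2 (f - k\<^sub>2) = 0"
      and le: "(norm f)\<^sup>2 \<le> (norm k\<^sub>1)\<^sup>2 + (norm k\<^sub>2)\<^sup>2 + c\<^sup>2" by blast
  have sub2: "strict_mono (\<lambda>m::nat. 2 * m)" by (auto simp: strict_mono_def)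
  have "(norm k\<^sub>1)\<^sup>2 \<le> measure \<xi> {0}"
    using norm_kernel_part_le[OF N(1) \<xi>.integrable_monomial(1) mom(1) k(1,2)]
    by (intro LIMSEQ_le_const[OF LIMSEQ_subseq_LIMSEQ[OF \<xi>.compl_power_tendsto_atom sub2]]) (auto simp: comp_def)
  moreover have "(norm k\<^sub>2)\<^sup>2 \<le> measure \<eta> {0}"
    using norm_kernel_part_le[OF N(2) \<eta>.integrable_monomial(1) mom(2) k(3,4)]
    by (intro LIMSEQ_le_const[OF LIMSEQ_subseq_LIMSEQ[OF \<eta>.compl_power_tendsto_atom sub2]]) (auto simp: comp_def)
  moreover have "norm f = 1" by (simp add: f_def V)
  ultimately show ?thesis using le by simp
qed

end

lemma SFC_flat_contractive_pair:
  assumes "SFC TYPE('k1::chilbert_space) TYPE('k2::chilbert_space) \<alpha> \<beta>"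
  shows "flat_contractive_pair \<alpha> \<beta>"
proof -
  from assms interpret weighted_shift_pair \<alpha> \<beta> by unfold_locales (simp add: SFC_def)
  have "\<alpha> k \<le> 1" "\<beta> k \<le> 1" for k
  proof -
    have "onorm (shift_op right_step \<alpha>) \<le> 1" "onorm (shift_op up_step \<beta>) \<le> 1"
      using assms by (simp_all add: SFC_def T1_of_def T2_of_def)
    then show "\<alpha> k \<le> 1" "\<beta> k \<le> 1"
      using weight_le_onorm[OF inj_steps(1) bounded_weights(1), of k]
        weight_le_onorm[OF inj_steps(2) bounded_weights(2), of k] by linarith+
  qed
  then show ?thesis using assms by unfold_locales (auto simp: SFC_def)
qed

theorem theorem5p10:
  fixes \<alpha> \<beta> :: "nat \<times> nat \<Rightarrow> real"
    and x y :: "nat \<Rightarrow> real"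
    and a p q u v h s :: real
    and \<xi> \<eta> \<eta>\<^sub>1 \<rho> \<sigma> :: "real measure"
  assumes SFC: "SFC TYPE('k1::chilbert_space) TYPE('k2::chilbert_space) \<alpha> \<beta>"
    and x: "\<And>n. x n = \<alpha> (n, 0)"
    and y: "\<And>n. y n = \<beta> (0, n)"
    and a: "a = \<alpha> (0, 1)"
    and \<xi>: "berger_measure x \<xi>"
    and \<eta>: "berger_measure y \<eta>"
    and \<eta>\<^sub>1: "berger_measure (\<lambda>n. y (Suc n)) \<eta>\<^sub>1"
    and pq: "0 < p" "p < 1" "0 < q" "q < 1" "p + q \<le> 1"
    and uv: "0 < u" "u < 1" "0 < v" "v < 1" "u + v \<le> 1"
    and \<rho>: "borel_prob \<rho>" "measure \<rho> ({0} \<union> {1}) = 0"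
    and \<sigma>: "borel_prob \<sigma>" "measure \<sigma> ({0} \<union> {1}) = 0"
    and \<xi>_decomp: "two_atom_mixture p q \<rho> \<xi>"
    and \<eta>_decomp: "two_atom_mixture u v \<sigma> \<eta>"
    and h: "h = sqrt (((x 0)\<^sup>2 * (y 1)\<^sup>2 * ((x 1)\<^sup>2 - (x 0)\<^sup>2)) /
                      ((x 0)\<^sup>2 * ((x 1)\<^sup>2 - (x 0)\<^sup>2) + (a\<^sup>2 - (x 0)\<^sup>2)\<^sup>2))"
    and s: "s = min (sqrt (q / a\<^sup>2)) (sqrt (p / (L1_norm \<eta>\<^sub>1 (\<lambda>t. 1 / t) - a\<^sup>2)))"
    and y1: "y 1 < 1"
    and a_range: "x 0 * sqrt ((1 - (x 1)\<^sup>2) / (1 - (x 0)\<^sup>2)) < a" "a \<le> x 0"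
    and pq_lt: "p + q < 1"
  shows "{s<..h} \<noteq> {} \<and>
    (y 0 \<in> {s<..h} \<longrightarrow>
       hyponormal_pair (T1_of \<alpha>) (T2_of \<beta>) \<and>
       \<not> subnormal_pair TYPE('k::chilbert_space) (T1_of \<alpha>) (T2_of \<beta>))"
proof -
  interpret flat_contractive_pair \<alpha> \<beta>
    by (rule SFC_flat_contractive_pair[OF SFC])
  let ?c = "a * y 0"
  have x': "x = (\<lambda>n. \<alpha> (n, 0))" and y': "y = (\<lambda>n. \<beta> (0, n))" using x y by auto
  have pos: "0 < x n" "0 < y n" "x n \<le> 1" "y n \<le> 1" "0 < a" for n
    using weights_pos le_1 by (simp_all add: x y a)
  have abs1: "\<bar>x n\<bar> \<le> 1" "\<bar>y n\<bar> \<le> 1" for n using pos(1-4)[of n] by simp_all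
  interpret \<xi>: unit_interval_prob \<xi> by (rule berger_unit_interval(1)[OF \<xi> abs1(1)])
  interpret \<eta>: unit_interval_prob \<eta> by (rule berger_unit_interval(1)[OF \<eta> abs1(2)])
  interpret \<eta>\<^sub>1: unit_interval_prob \<eta>\<^sub>1 by (rule berger_unit_interval(1)[OF \<eta>\<^sub>1 abs1(2)])
  note atoms = two_atom_mixture_atoms[OF \<xi>_decomp \<rho>] two_atom_mixture_atoms[OF \<eta>_decomp \<sigma>]
  have c_le: "?c\<^sup>2 \<le> q" "?c\<^sup>2 \<le> v"
    using c_le_atom[OF \<xi>[unfolded x'] \<eta>[unfolded y']] by (simp_all add: atoms a y c_def)
  have X: "(x 0)\<^sup>2 = (\<integral>t. t \<partial>\<xi>)" "(x 0)\<^sup>2 * (x 1)\<^sup>2 = (\<integral>t. t\<^sup>2 \<partial>\<xi>)"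
    using berger_unit_interval(2)[OF \<xi> abs1(1), of 1] berger_unit_interval(2)[OF \<xi> abs1(1), of 2]
    by (simp_all add: numeral_2_eq_2)
  have Y: "(y 0)\<^sup>2 = (\<integral>t. t \<partial>\<eta>)" "(y 0)\<^sup>2 * (y 1)\<^sup>2 = (\<integral>t. t\<^sup>2 \<partial>\<eta>)"
    using berger_unit_interval(2)[OF \<eta> abs1(2), of 1] berger_unit_interval(2)[OF \<eta> abs1(2), of 2]
    by (simp_all add: numeral_2_eq_2)
  have x0: "q \<le> (x 0)\<^sup>2" "(x 0)\<^sup>2 \<le> 1 - p"
    using \<xi>.atoms_le_integral[of "\<lambda>t. t"] \<xi>.atoms_le_integral[of "\<lambda>t. 1 - t"] \<xi>.prob_space
    by (simp_all add: X atoms)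
  have y0: "0 < (y 0)\<^sup>2" using pos(2)[of 0] by simp
  have A: "0 < a\<^sup>2" "a\<^sup>2 < 1"
  proof -
    have "a\<^sup>2 \<le> (x 0)\<^sup>2" using a_range(2) pos by (intro power_mono) auto
    then show "a\<^sup>2 < 1" using x0(2) pq by simp
  qed (use pos in simp)
  have L: "L1_norm \<eta>\<^sub>1 (\<lambda>t. 1 / t) = (1 - u) / (y 0)\<^sup>2"
  proof -
    have "(\<integral>t. t ^ k \<partial>\<eta>\<^sub>1) = 1 / (y 0)\<^sup>2 * (\<integral>t. t ^ Suc k \<partial>\<eta>)" for k
    proof -
      have "(\<integral>t. t ^ Suc k \<partial>\<eta>) = (y 0)\<^sup>2 * (\<Prod>i<k. (y (Suc i))\<^sup>2)"
        unfolding berger_unit_interval(2)[OF \<eta> abs1(2), symmetric] by (rule prod.lessThan_Suc_shift)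
      then show ?thesis using y0 berger_unit_interval(2)[OF \<eta>\<^sub>1 abs1(2), of k] by simp
    qed
    from \<eta>\<^sub>1.integral_inverse_of_shifted_moments[OF \<eta>.unit_interval_prob_axioms _ this]
    show ?thesis by (simp add: L1_norm_def atoms)
  qed
  define l where "l = L1_norm \<eta>\<^sub>1 (\<lambda>t. 1 / t) - a\<^sup>2"
  have l_eq: "l * (y 0)\<^sup>2 = 1 - u - ?c\<^sup>2"
    using y0 by (simp add: l_def L power_mult_distrib field_simps)
  \<comment> \<open>The Cauchy-Schwarz inequality for \<open>\<eta> - u \<delta>\<^sub>0 - c\<^sup>2 \<delta>\<^sub>1\<close>, whose mass is \<open>l y\<^sub>0\<^sup>2\<close>.\<close>
  have "((y 0)\<^sup>2 - ?c\<^sup>2)\<^sup>2 \<le> (1 - u - ?c\<^sup>2) * ((y 0)\<^sup>2 * (y 1)\<^sup>2 - ?c\<^sup>2)"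
    using \<eta>.moment_determinant_0[of "?c\<^sup>2"] c_le(2) by (simp add: atoms flip: Y)
  also have "\<dots> = (y 0)\<^sup>2 * (y 0)\<^sup>2 * (l * ((y 1)\<^sup>2 - a\<^sup>2))"
    unfolding l_eq[symmetric] by (simp add: power_mult_distrib algebra_simps)
  finally have "(y 0)\<^sup>2 * (y 0)\<^sup>2 * (1 - a\<^sup>2)\<^sup>2 \<le> (y 0)\<^sup>2 * (y 0)\<^sup>2 * (l * ((y 1)\<^sup>2 - a\<^sup>2))"
    by (simp add: power2_eq_square algebra_simps)
  then have det: "(1 - a\<^sup>2)\<^sup>2 \<le> l * ((y 1)\<^sup>2 - a\<^sup>2)" using y0 by (simp add: mult_le_cancel_left)
  have "0 \<le> l * (y 0)\<^sup>2" using l_eq c_le(2) uv by simp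
  then have "0 \<le> l" using y0 by (simp add: zero_le_mult_iff)
  moreover have "l \<noteq> 0" using det A by auto
  ultimately have l: "0 < l" by simp
  have s_eq: "s = sqrt (min (q / a\<^sup>2) (p / l))"
    unfolding s l_def by (simp add: min_def)
  have "min (q / a\<^sup>2) (p / l) < (y 1)\<^sup>2 * ((x 0)\<^sup>2 * (x 1)\<^sup>2 - ((x 0)\<^sup>2)\<^sup>2)
      / ((x 0)\<^sup>2 * (x 1)\<^sup>2 - ((x 0)\<^sup>2)\<^sup>2 + (a\<^sup>2 - (x 0)\<^sup>2)\<^sup>2)"
  proof (rule min_less_ratio[OF pq(1,3) pq_lt A x0 _ l det])
    show "p * m\<^sup>2 + q * (1 - m)\<^sup>2 \<le> (x 0)\<^sup>2 * (x 1)\<^sup>2 - 2 * m * (x 0)\<^sup>2 + m\<^sup>2" for m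
      using \<xi>.atoms_le_integral[OF \<xi>.integral_shifted_square(2)[of 0 m]] \<xi>.integral_shifted_square(1)[of 0 m]
        \<xi>.prob_space X by (simp add: atoms power2_eq_square)
  qed
  also have "\<dots> = (x 0)\<^sup>2 * (y 1)\<^sup>2 * ((x 1)\<^sup>2 - (x 0)\<^sup>2) / ((x 0)\<^sup>2 * ((x 1)\<^sup>2 - (x 0)\<^sup>2) + (a\<^sup>2 - (x 0)\<^sup>2)\<^sup>2)"
    by (simp add: power2_eq_square algebra_simps)
  finally have "s < h" unfolding s_eq h by simp
  then have "{s<..h} \<noteq> {}" by simp
  moreover have "hyponormal_pair (T1_of \<alpha>) (T2_of \<beta>)" if "y 0 \<le> h"
  proof (rule hyponormal_if_corner[OF \<xi>[unfolded x'] \<eta>[unfolded y']])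
    let ?N = "(x 0)\<^sup>2 * (y 1)\<^sup>2 * ((x 1)\<^sup>2 - (x 0)\<^sup>2)" and ?D = "(x 0)\<^sup>2 * ((x 1)\<^sup>2 - (x 0)\<^sup>2) + (a\<^sup>2 - (x 0)\<^sup>2)\<^sup>2"
    have "(x 0)\<^sup>2 \<le> (x 1)\<^sup>2"
      using edge_six_point(1)[OF \<xi>.unit_interval_prob_axioms berger_unit_interval(2)[OF \<xi> abs1(1)] pos(1), of 0] by simp
    then have D0: "0 \<le> ?D" by simp
    have y0h: "(y 0)\<^sup>2 \<le> ?N / ?D"
      using that pos(2)[of 0] h by (metis less_imp_le real_le_rsqrt real_sqrt_le_iff real_sqrt_unique sqrt_le_D)
    \<comment> \<open>A vanishing denominator would mean \<open>h = 0\<close>, by \<open>z / 0 = 0\<close>.\<close>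
    then have "?D \<noteq> 0" using y0 by auto
    then have "(y 0)\<^sup>2 * ?D \<le> ?N" using y0h D0 by (simp add: pos_le_divide_eq)
    then have "(y 0)\<^sup>2 * (a\<^sup>2 - (x 0)\<^sup>2)\<^sup>2 \<le> (x 0)\<^sup>2 * (((x 1)\<^sup>2 - (x 0)\<^sup>2) * ((y 1)\<^sup>2 - (y 0)\<^sup>2))"
      by (simp add: algebra_simps)
    moreover have "(x 0)\<^sup>2 * (\<beta> (1, 0) * a - x 0 * y 0)\<^sup>2 = (y 0)\<^sup>2 * (a\<^sup>2 - (x 0)\<^sup>2)\<^sup>2"
    proof -
      have "x 0 * (\<beta> (1, 0) * a - x 0 * y 0) = y 0 * (a\<^sup>2 - (x 0)\<^sup>2)"
        using weights_commute[of 0 0] by (simp add: x y a power2_eq_square algebra_simps)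
      then show ?thesis by (metis power_mult_distrib)
    qed
    ultimately have "(x 0)\<^sup>2 * (\<beta> (1, 0) * a - x 0 * y 0)\<^sup>2
        \<le> (x 0)\<^sup>2 * (((x 1)\<^sup>2 - (x 0)\<^sup>2) * ((y 1)\<^sup>2 - (y 0)\<^sup>2))"
      by simp
    then have "(\<beta> (1, 0) * a - x 0 * y 0)\<^sup>2 \<le> ((x 1)\<^sup>2 - (x 0)\<^sup>2) * ((y 1)\<^sup>2 - (y 0)\<^sup>2)"
      by (rule mult_left_le_imp_le) (use pos(1)[of 0] in simp)
    then show "(\<beta> (1, 0) * \<alpha> (0, 1) - \<alpha> (0, 0) * \<beta> (0, 0))\<^sup>2
      \<le> ((\<alpha> (1, 0))\<^sup>2 - (\<alpha> (0, 0))\<^sup>2) * ((\<beta> (0, 1))\<^sup>2 - (\<beta> (0, 0))\<^sup>2)"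
      by (simp add: x y a)
  qed
  moreover have "\<not> subnormal_pair TYPE('k) (T1_of \<alpha>) (T2_of \<beta>)" if "s < y 0"
  proof
    assume "subnormal_pair TYPE('k) (T1_of \<alpha>) (T2_of \<beta>)"
    from subnormal_imp_mass_bound[OF \<xi>[unfolded x'] \<eta>[unfolded y'] this]
    have bound: "1 \<le> p + u + ?c\<^sup>2" by (simp add: atoms a y c_def)
    have "min (q / a\<^sup>2) (p / l) < (y 0)\<^sup>2"
      using that pos(2)[of 0] unfolding s_eq by (metis less_imp_le real_sqrt_less_iff real_sqrt_abs abs_of_pos)
    moreover have "(y 0)\<^sup>2 \<le> q / a\<^sup>2" using c_le(1) A by (simp add: field_simps power_mult_distrib)
    ultimately have "p / l < (y 0)\<^sup>2" by simp
    then have "p < 1 - u - ?c\<^sup>2" using l l_eq by (simp add: field_simps)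
    then show False using bound by simp
  qed
  ultimately show ?thesis by simp
qed

end
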